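(* Let $(M,g)$ be a four-dimensional Lie group equipped with a left-invariant pseudo-Riemannian metric (of Lorentzian or neutral signature) which is conformally flat and not Ricci-parallel, and whose Ricci operator is of Segre type $[1,(12)]$ or $[(1,3)]$. Then $(M,g)$ does not admit a left-invariant Walker structure.
   Context: Conventions. $\nabla$ is the Levi-Civita connection, $R(X,Y)=[\nabla_X,\nabla_Y]-\nabla_{[X,Y]}$, the Ricci tensor is $\varrho(X,Y)=\sum_i\varepsilon_i\,g(R(e_i,X)Y,e_i)$ for a pseudo-orthonormal basis $\{e_i\}$ with $\varepsilon_i=g(e_i,e_i)=\pm1$, and the Ricci operator $Q$ is defined by $g(QX,Y)=\varrho(X,Y)$. Not Ricci-parallel means $\nabla\varrho\neq0$. The signature is Lorentzian $(3,1)$ or neutral $(2,2)$. Segre types: the digits list the sizes of the Jordan blocks of the self-adjoint operator $Q$; blocks enclosed in round brackets share the same eigenvalue, and blocks not enclosed together have different eigenvalues. A digit $1$ before the comma corresponds to a spacelike eigenvector. Thus: - $[1,(12)]$ (occurring in neutral signature): $Q$ has two distinct real eigenvalues $\lambda_1\ne\lambda_2$; $\lambda_1$ has a single Jordan block of size $1$, with spacelike eigenvector; $\lambda_2$ has one Jordan block of size $1$ and one Jordan block of size $2$. - $[(1,3)]$ (occurring in Lorentzian and in neutral signature): $Q$ has a single real eigenvalue with one Jordan block of size $1$ (with spacelike eigenvector orthogonal to the other block) and one Jordan block of size $3$. Walker structure: a left-invariant Walker structure is a distribution $\mathcal D$ of rank $1$ or $2$, spanned by left-invariant vector fields, such that $g$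 vanishes identically on $\mathcal D$ and $\nabla_XY\in\mathcal D$ for every vector field $X$ and every section $Y$ of $\mathcal D$ (a parallel null line field or a parallel null plane field). *)

theory Defs
  imports "HOL-Analysis.Analysis"
begin

section \<open>Smooth functions between Euclidean spaces\<close>

text \<open>Only used for open \<open>S\<close>, where a map is \<open>k + 1\<close> times continuously differentiable iff it is
  differentiable and all its directional derivatives are \<open>k\<close> times continuously differentiable.\<close>

fun Ck_on :: "nat \<Rightarrow> 'a::euclidean_space set \<Rightarrow> ('a \<Rightarrow> 'b::real_normed_vector) \<Rightarrow> bool" where
  "Ck_on 0 S f \<longleftrightarrow> continuous_on S f"
| "Ck_on (Suc k) S f \<longleftrightarrow>
     f differentiable_on S \<and> (\<forall>v. Ck_on k S (\<lambda>x. frechet_derivative f (at x) v))"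

definition smooth_on :: "'a::euclidean_space set \<Rightarrow> ('a \<Rightarrow> 'b::real_normed_vector) \<Rightarrow> bool" where
  "smooth_on S f \<longleftrightarrow> (\<forall>k. Ck_on k S f)"

section \<open>Four-dimensional Lie groups\<close>

type_synonym 'g chart = "'g set \<times> ('g \<Rightarrow> real ^ 4)"

definition is_chart :: "'g::topological_space chart \<Rightarrow> bool" where
  "is_chart c \<longleftrightarrow> (case c of (U, x) \<Rightarrow>
     open U \<and> open (x ` U) \<and> homeomorphism U (x ` U) x (inv_into U x))"

definition smooth_transition :: "'g chart \<Rightarrow> 'g chart \<Rightarrow> bool" where
  "smooth_transition c d \<longleftrightarrow> (case (c, d) of ((U, x), (V, y)) \<Rightarrow>
     smooth_on (x ` (U \<inter> V)) (y \<circ> inv_into U x))"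

definition smooth_atlas :: "'g::topological_space chart set \<Rightarrow> bool" where
  "smooth_atlas A \<longleftrightarrow>
     (\<forall>c\<in>A. is_chart c) \<and> (\<Union>(fst ` A)) = UNIV \<and> (\<forall>c\<in>A. \<forall>d\<in>A. smooth_transition c d)"

text \<open>The group is written additively, because \<open>group_add\<close> is the type class of arbitrary groups;
  commutativity is not assumed.\<close>

definition lie_group ::
  "'g::{topological_group_add, t2_space, second_countable_topology} chart set \<Rightarrow> bool" where
  "lie_group A \<longleftrightarrow> smooth_atlas A \<and>
     (\<forall>(U, x)\<in>A. \<forall>(V, y)\<in>A. \<forall>(W, z)\<in>A.
        smooth_on {(x a, y b) | a b. a \<in> U \<and> b \<in> V \<and> a + b \<in> W}
          (\<lambda>(s, t). z (inv_into U x s + inv_into V y t))) \<and>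
     (\<forall>(U, x)\<in>A. \<forall>(V, y)\<in>A.
        smooth_on {x a | a. a \<in> U \<and> - a \<in> V} (\<lambda>s. y (- inv_into U x s)))"

definition smooth_fun_on :: "'g::topological_space chart set \<Rightarrow> 'g set \<Rightarrow> ('g \<Rightarrow> real) \<Rightarrow> bool" where
  "smooth_fun_on A S f \<longleftrightarrow> (\<forall>(U, x)\<in>A. smooth_on (x ` (U \<inter> S)) (f \<circ> inv_into U x))"

definition smooth_near :: "'g::topological_space chart set \<Rightarrow> 'g \<Rightarrow> ('g \<Rightarrow> real) \<Rightarrow> bool" where
  "smooth_near A p f \<longleftrightarrow> (\<exists>U. open U \<and> p \<in> U \<and> smooth_fun_on A U f)"

section \<open>Tangent vectors and vector fields\<close>

text \<open>A tangent vector at \<open>p\<close> is a directional derivative at \<open>p\<close>, acting on the functions that are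
  smooth near \<open>p\<close>. As HOL functions are total, it is given the value 0 on all other functions;
  equality of functionals is then equality of tangent vectors.\<close>

type_synonym 'g tvec = "('g \<Rightarrow> real) \<Rightarrow> real"
type_synonym 'g vfield = "'g \<Rightarrow> 'g tvec"

definition tangent_space :: "'g::topological_space chart set \<Rightarrow> 'g \<Rightarrow> 'g tvec set" where
  "tangent_space A p =
     {v. \<exists>(U, x)\<in>A. p \<in> U \<and> (\<exists>w. v = (\<lambda>f. if smooth_near A p f
            then frechet_derivative (f \<circ> inv_into U x) (at (x p)) w else 0))}"

definition vector_field :: "'g::topological_space chart set \<Rightarrow> 'g vfield \<Rightarrow> bool" where
  "vector_field A X \<longleftrightarrow> (\<forall>p. X p \<in> tangent_space A p) \<and>
     (\<forall>U f. open U \<longrightarrow> smooth_fun_on A U f \<longrightarrow> smooth_fun_on A U (\<lambda>p. X p f))"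

definition vadd :: "'g vfield \<Rightarrow> 'g vfield \<Rightarrow> 'g vfield" where
  "vadd X Y = (\<lambda>p f. X p f + Y p f)"

definition fscale :: "('g \<Rightarrow> real) \<Rightarrow> 'g vfield \<Rightarrow> 'g vfield" where
  "fscale h X = (\<lambda>p f. h p * X p f)"

definition vdiff :: "'g vfield \<Rightarrow> 'g vfield \<Rightarrow> 'g vfield" where
  "vdiff X Y = (\<lambda>p f. X p f - Y p f)"

definition lie_bracket ::
  "'g::topological_space chart set \<Rightarrow> 'g vfield \<Rightarrow> 'g vfield \<Rightarrow> 'g vfield" where
  "lie_bracket A X Y =
     (\<lambda>p f. if smooth_near A p f then X p (\<lambda>q. Y q f) - Y p (\<lambda>q. X q f) else 0)"

text \<open>The differential of the left translation \<open>q \<mapsto> a + q\<close>.\<close>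

definition dL :: "'g::plus \<Rightarrow> 'g tvec \<Rightarrow> 'g tvec" where
  "dL a v = (\<lambda>f. v (\<lambda>q. f (a + q)))"

definition left_invariant ::
  "'g::{topological_space, plus} chart set \<Rightarrow> 'g vfield \<Rightarrow> bool" where
  "left_invariant A X \<longleftrightarrow> vector_field A X \<and> (\<forall>a p. X (a + p) = dL a (X p))"

text \<open>\<open>r\<close> left-invariant vector fields \<open>V 0, \<dots>, V (r - 1)\<close> that are linearly independent at every
  point; for \<open>r = 4\<close> this is a basis of the Lie algebra.\<close>

definition left_invariant_frame ::
  "'g::{topological_space, plus} chart set \<Rightarrow> nat \<Rightarrow> (nat \<Rightarrow> 'g vfield) \<Rightarrow> bool" where
  "left_invariant_frame A r V \<longleftrightarrow> (\<forall>i<r. left_invariant A (V i)) \<and>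
     (\<forall>p c. (\<forall>f. (\<Sum>i<r. c i * V i p f) = 0) \<longrightarrow> (\<forall>i<r. c i = 0))"

section \<open>Left-invariant pseudo-Riemannian metrics\<close>

type_synonym 'g metric = "'g \<Rightarrow> 'g tvec \<Rightarrow> 'g tvec \<Rightarrow> real"

definition pseudo_riemannian_metric ::
  "'g::topological_space chart set \<Rightarrow> 'g metric \<Rightarrow> bool" where
  "pseudo_riemannian_metric A g \<longleftrightarrow>
     (\<forall>p. \<forall>u\<in>tangent_space A p. \<forall>v\<in>tangent_space A p. g p u v = g p v u) \<and>
     (\<forall>p a b. \<forall>u\<in>tangent_space A p. \<forall>v\<in>tangent_space A p. \<forall>w\<in>tangent_space A p.
        g p (\<lambda>f. a * u f + b * v f) w = a * g p u w + b * g p v w) \<and>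
     (\<forall>p. \<forall>u\<in>tangent_space A p. (\<forall>v\<in>tangent_space A p. g p u v = 0) \<longrightarrow> u = (\<lambda>f. 0)) \<and>
     (\<forall>X Y. vector_field A X \<longrightarrow> vector_field A Y \<longrightarrow>
        smooth_fun_on A UNIV (\<lambda>p. g p (X p) (Y p)))"

definition left_invariant_metric ::
  "'g::{topological_space, plus} chart set \<Rightarrow> 'g metric \<Rightarrow> bool" where
  "left_invariant_metric A g \<longleftrightarrow> pseudo_riemannian_metric A g \<and>
     (\<forall>a p. \<forall>u\<in>tangent_space A p. \<forall>v\<in>tangent_space A p.
        g (a + p) (dL a u) (dL a v) = g p u v)"

definition pseudo_orthonormal_basis ::
  "'g::topological_space chart set \<Rightarrow> 'g metric \<Rightarrow> 'g \<Rightarrow> (4 \<Rightarrow> 'g tvec) \<Rightarrow> bool" where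
  "pseudo_orthonormal_basis A g p e \<longleftrightarrow>
     (\<forall>i. e i \<in> tangent_space A p) \<and>
     (\<forall>v\<in>tangent_space A p. \<exists>c. v = (\<lambda>f. \<Sum>i\<in>UNIV. c i * e i f)) \<and>
     (\<forall>i. g p (e i) (e i) \<in> {1, -1}) \<and>
     (\<forall>i j. i \<noteq> j \<longrightarrow> g p (e i) (e j) = 0)"

definition has_signature ::
  "'g::topological_space chart set \<Rightarrow> 'g metric \<Rightarrow> nat \<Rightarrow> nat \<Rightarrow> bool" where
  "has_signature A g r s \<longleftrightarrow> (\<forall>p. \<exists>e. pseudo_orthonormal_basis A g p e \<and>
     card {i. g p (e i) (e i) = 1} = r \<and> card {i. g p (e i) (e i) = -1} = s)"

abbreviation lorentzian :: "'g::topological_space chart set \<Rightarrow> 'g metric \<Rightarrow> bool" where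
  "lorentzian A g \<equiv> has_signature A g 3 1"

abbreviation neutral :: "'g::topological_space chart set \<Rightarrow> 'g metric \<Rightarrow> bool" where
  "neutral A g \<equiv> has_signature A g 2 2"

text \<open>Near every point there are smooth coordinates \<open>x\<close>, compatible with the atlas, in which
  \<open>g = exp (2 \<sigma>) * (\<Sum>i. \<epsilon> i * (dx i)\<^sup>2)\<close>, where \<open>dx i (u) = u (x i)\<close>.\<close>

definition conformally_flat :: "'g::topological_space chart set \<Rightarrow> 'g metric \<Rightarrow> bool" where
  "conformally_flat A g \<longleftrightarrow>
     (\<forall>p. \<exists>U x \<sigma> \<epsilon>. p \<in> U \<and> smooth_atlas (insert (U, x) A) \<and> smooth_fun_on A U \<sigma> \<and>
        (\<forall>i::4. \<epsilon> i \<in> {1, -1}) \<and>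
        (\<forall>q\<in>U. \<forall>u\<in>tangent_space A q. \<forall>v\<in>tangent_space A q.
           g q u v = exp (2 * \<sigma> q) *
             (\<Sum>i\<in>UNIV. \<epsilon> i * u (\<lambda>r. x r $ i) * v (\<lambda>r. x r $ i))))"

section \<open>Connection and curvature\<close>

type_synonym 'g connection = "'g vfield \<Rightarrow> 'g vfield \<Rightarrow> 'g vfield"

definition affine_connection ::
  "'g::topological_space chart set \<Rightarrow> 'g connection \<Rightarrow> bool" where
  "affine_connection A nab \<longleftrightarrow>
     (\<forall>X Y. vector_field A X \<longrightarrow> vector_field A Y \<longrightarrow> vector_field A (nab X Y)) \<and>
     (\<forall>X Y Z. vector_field A X \<longrightarrow> vector_field A Y \<longrightarrow> vector_field A Z \<longrightarrow>
        nab (vadd X Y) Z = vadd (nab X Z) (nab Y Z) \<and>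
        nab X (vadd Y Z) = vadd (nab X Y) (nab X Z)) \<and>
     (\<forall>h X Y. smooth_fun_on A UNIV h \<longrightarrow> vector_field A X \<longrightarrow> vector_field A Y \<longrightarrow>
        nab (fscale h X) Y = fscale h (nab X Y) \<and>
        nab X (fscale h Y) = vadd (fscale (\<lambda>p. X p h) Y) (fscale h (nab X Y)))"

definition levi_civita ::
  "'g::topological_space chart set \<Rightarrow> 'g metric \<Rightarrow> 'g connection \<Rightarrow> bool" where
  "levi_civita A g nab \<longleftrightarrow> affine_connection A nab \<and>
     (\<forall>X Y. vector_field A X \<longrightarrow> vector_field A Y \<longrightarrow>
        vdiff (nab X Y) (nab Y X) = lie_bracket A X Y) \<and>
     (\<forall>X Y Z p. vector_field A X \<longrightarrow> vector_field A Y \<longrightarrow> vector_field A Z \<longrightarrow>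
        X p (\<lambda>q. g q (Y q) (Z q)) = g p (nab X Y p) (Z p) + g p (Y p) (nab X Z p))"

definition curvature ::
  "'g::topological_space chart set \<Rightarrow> 'g connection \<Rightarrow>
    'g vfield \<Rightarrow> 'g vfield \<Rightarrow> 'g vfield \<Rightarrow> 'g vfield" where
  "curvature A nab X Y Z =
     vdiff (vdiff (nab X (nab Y Z)) (nab Y (nab X Z))) (nab (lie_bracket A X Y) Z)"

text \<open>A left-invariant pseudo-orthonormal frame exists for every left-invariant metric, and the Ricci
  tensor does not depend on the choice of the frame.\<close>

definition some_frame ::
  "'g::{topological_space, plus} chart set \<Rightarrow> 'g metric \<Rightarrow> 4 \<Rightarrow> 'g vfield" where
  "some_frame A g = (SOME E. (\<forall>i. left_invariant A (E i)) \<and>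
     (\<forall>p. pseudo_orthonormal_basis A g p (\<lambda>i. E i p)))"

definition ricci ::
  "'g::{topological_space, plus} chart set \<Rightarrow> 'g metric \<Rightarrow> 'g connection \<Rightarrow>
    'g vfield \<Rightarrow> 'g vfield \<Rightarrow> 'g \<Rightarrow> real" where
  "ricci A g nab X Y p = (let E = some_frame A g in
     \<Sum>i\<in>UNIV. g p (E i p) (E i p) * g p (curvature A nab (E i) X Y p) (E i p))"

definition ricci_operator ::
  "'g::{topological_space, plus} chart set \<Rightarrow> 'g metric \<Rightarrow> 'g connection \<Rightarrow>
    ('g vfield \<Rightarrow> 'g vfield) \<Rightarrow> bool" where
  "ricci_operator A g nab Q \<longleftrightarrow> (\<forall>X. vector_field A X \<longrightarrow> vector_field A (Q X) \<and>
     (\<forall>Y p. vector_field A Y \<longrightarrow> g p (Q X p) (Y p) = ricci A g nab X Y p))"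

definition ricci_parallel ::
  "'g::{topological_space, plus} chart set \<Rightarrow> 'g metric \<Rightarrow> 'g connection \<Rightarrow> bool" where
  "ricci_parallel A g nab \<longleftrightarrow>
     (\<forall>X Y Z p. vector_field A X \<longrightarrow> vector_field A Y \<longrightarrow> vector_field A Z \<longrightarrow>
        X p (ricci A g nab Y Z) - ricci A g nab (nab X Y) Z p - ricci A g nab Y (nab X Z) p = 0)"

section \<open>Segre types and Walker structures\<close>

definition jordan_block ::
  "('g vfield \<Rightarrow> 'g vfield) \<Rightarrow> real \<Rightarrow> nat \<Rightarrow> (nat \<Rightarrow> 'g vfield) \<Rightarrow> bool" where
  "jordan_block Q l n V \<longleftrightarrow>
     (\<forall>j<n. Q (V j) = (\<lambda>p f. l * V j p f + (if j = 0 then 0 else V (j - 1) p f)))"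

text \<open>Left-invariance makes the Ricci operator act on the Lie algebra of left-invariant vector fields;
  the Jordan form is that of this endomorphism. The block sizes are those of a Jordan basis
  \<open>V 0, \<dots>, V 3\<close> of the Lie algebra.\<close>

definition segre_1_c_12 ::
  "'g::{topological_space, plus} chart set \<Rightarrow> 'g metric \<Rightarrow> ('g vfield \<Rightarrow> 'g vfield) \<Rightarrow> bool" where
  "segre_1_c_12 A g Q \<longleftrightarrow> (\<exists>l1 l2 V. l1 \<noteq> l2 \<and> left_invariant_frame A 4 V \<and>
     jordan_block Q l1 1 V \<and>
     jordan_block Q l2 1 (\<lambda>j. V (1 + j)) \<and>
     jordan_block Q l2 2 (\<lambda>j. V (2 + j)) \<and>
     (\<forall>p. g p (V 0 p) (V 0 p) > 0))"

definition segre_13 ::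
  "'g::{topological_space, plus} chart set \<Rightarrow> 'g metric \<Rightarrow> ('g vfield \<Rightarrow> 'g vfield) \<Rightarrow> bool" where
  "segre_13 A g Q \<longleftrightarrow> (\<exists>l V. left_invariant_frame A 4 V \<and>
     jordan_block Q l 1 V \<and>
     jordan_block Q l 3 (\<lambda>j. V (1 + j)) \<and>
     (\<forall>p. g p (V 0 p) (V 0 p) > 0 \<and> (\<forall>j\<in>{1..3}. g p (V 0 p) (V j p) = 0)))"

definition walker_structure ::
  "'g::{topological_space, plus} chart set \<Rightarrow> 'g metric \<Rightarrow> 'g connection \<Rightarrow>
    ('g \<Rightarrow> 'g tvec set) \<Rightarrow> bool" where
  "walker_structure A g nab D \<longleftrightarrow>
     (\<exists>r\<in>{1, 2}. \<exists>V. left_invariant_frame A r V \<and>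
        D = (\<lambda>p. {v. \<exists>c. v = (\<lambda>f. \<Sum>i<r. c i * V i p f)})) \<and>
     (\<forall>p. \<forall>u\<in>D p. \<forall>v\<in>D p. g p u v = 0) \<and>
     (\<forall>X Y. vector_field A X \<longrightarrow> vector_field A Y \<longrightarrow> (\<forall>p. Y p \<in> D p) \<longrightarrow>
        (\<forall>p. nab X Y p \<in> D p))"

end

theory Submission
  imports Defs
begin

text \<open>
  All the data are left-invariant, so they live on the Lie algebra: a nondegenerate symmetric
  bilinear form \<open>B\<close> for the metric and a bilinear map \<open>N\<close> with \<open>\<nabla>\<^sub>a b = N a b\<close>, both expressed in the
  coordinates of the Jordan basis of the Ricci operator. The proof has an analytic half, which
  transports the hypotheses to this algebra, and an algebraic half, which derives a contradiction.

  Analysis. If \<open>g = exp (2 \<sigma>) \<Sum> \<epsilon>\<^sub>k (dx\<^sub>k)\<^sup>2\<close>, the Koszul argument expresses the second derivatives of the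
  \<open>x\<^sub>k\<close> along left-invariant fields by their first derivatives and those of \<open>\<sigma>\<close>. Commuting a third
  derivative yields, at a single point, a symmetric form \<open>p\<close> such that the curvature is the
  Kulkarni-Nomizu product of \<open>p\<close> and \<open>B\<close> (lemmas \<open>conformal_curvature\<close> and \<open>flat_schouten\<close>). A
  contraction gives \<open>Q = \<tau> + 2 P\<close> where \<open>p\<close> is the form of the operator \<open>P\<close> (lemma \<open>schouten_operator\<close>);
  hence \<open>P\<close> has the same Jordan type as \<open>Q\<close>, and
  \<open>R(a, b) c = B b c P a + B (P b) c a - B a c P b - B (P a) c b\<close>.

  Algebra. The second Bianchi identity for this \<open>R\<close> contracts to the Codazzi equation
  \<open>(\<nabla>\<^sub>a P) b = (\<nabla>\<^sub>b P) a\<close>. A Walker structure becomes a totally null subspace \<open>D\<close>, of dimension 1 or 2 and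
  invariant under all \<open>\<nabla>\<^sub>a\<close>, hence under all \<open>R(a, b)\<close>. The form of \<open>R\<close> then forces \<open>P D \<subseteq> D\<close>
  (lemma \<open>walker_P\<close>), and also \<open>B (R(a, b) x) w = 0\<close> for \<open>x\<close> in \<open>D\<close> and \<open>w\<close> orthogonal to \<open>D\<close>.

  For the type \<open>[1,(12)]\<close> this is already contradictory. Let \<open>\<lambda>\<^sub>1\<close> be the simple eigenvalue of \<open>P\<close> and \<open>\<lambda>\<^sub>2\<close>
  the other one. The eigenvector \<open>e\<^sub>0\<close> of \<open>\<lambda>\<^sub>1\<close> is orthogonal to \<open>D\<close>, and taking \<open>w = e\<^sub>0\<close> shows that \<open>P = - \<lambda>\<^sub>1\<close> on \<open>D\<close>. So \<open>\<lambda>\<^sub>2 = - \<lambda>\<^sub>1\<close> and \<open>D\<close> is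
  spanned by the null eigenvector of the block of size 2; the eigenvector of the other block with
  eigenvalue \<open>\<lambda>\<^sub>2\<close> is then orthogonal to \<open>D\<close> and gives \<open>\<lambda>\<^sub>2 = 0\<close>, against \<open>\<lambda>\<^sub>1 \<noteq> \<lambda>\<^sub>2\<close>.

  For the type \<open>[(1,3)]\<close>, with Jordan chain \<open>e\<^sub>3 \<mapsto> e\<^sub>2 \<mapsto> e\<^sub>1 \<mapsto> 0\<close> of the nilpotent part, \<open>D\<close> contains \<open>e\<^sub>1\<close>,
  and the curvature forces the eigenvalue to vanish. The Codazzi equation then leaves so few
  components of \<open>\<nabla>e\<^sub>1\<close> that \<open>B (R(e\<^sub>0, e\<^sub>3) e\<^sub>1) e\<^sub>0 = 0\<close> becomes \<open>(B (N e\<^sub>3 e\<^sub>1) e\<^sub>0)\<^sup>2 = 0\<close>. Together with the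
  Walker condition this leaves \<open>N e\<^sub>3 e\<^sub>1\<close> as a multiple of \<open>e\<^sub>1\<close>, makes all other \<open>N e\<^sub>i e\<^sub>1\<close> vanish, and
  removes the component of \<open>[e\<^sub>2, e\<^sub>3]\<close> along \<open>e\<^sub>3\<close>. Thus \<open>B (R(e\<^sub>2, e\<^sub>3) e\<^sub>1) e\<^sub>3 = 0\<close>, but this number is
  \<open>(B e\<^sub>1 e\<^sub>3)\<^sup>2 \<noteq> 0\<close>.
\<close>

section \<open>Calculus of smooth functions\<close>

lemma Ck_on_Suc_has_derivative:
  assumes "open S" "Ck_on (Suc k) S f" "x \<in> S"
  shows "(f has_derivative frechet_derivative f (at x)) (at x)"
  using assms by (metis Ck_on.simps(2) at_within_open differentiable_on_def frechet_derivative_works)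

lemma Ck_on_cong:
  fixes f g :: "'a::euclidean_space \<Rightarrow> 'b::real_normed_vector"
  assumes "open S" and "\<And>x. x \<in> S \<Longrightarrow> f x = g x" and "Ck_on k S f"
  shows "Ck_on k S g"
  using assms(2,3)
proof (induction k arbitrary: f g)
  case 0
  then show ?case using continuous_on_cong[of S S f g] by simp
next
  case (Suc k)
  have g: "(g has_derivative frechet_derivative f (at x)) (at x)" if "x \<in> S" for x
    by (rule has_derivative_transform_within_open[OF
          Ck_on_Suc_has_derivative[OF \<open>open S\<close> Suc.prems(2) that] \<open>open S\<close> that])
      (rule Suc.prems(1))
  have D: "frechet_derivative f (at x) = frechet_derivative g (at x)" if "x \<in> S" for x
    by (rule frechet_derivative_at[OF g[OF that]])
  have "g differentiable_on S"
    unfolding differentiable_on_def using g differentiableI differentiable_at_withinI by blast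
  moreover have "Ck_on k S (\<lambda>x. frechet_derivative g (at x) v)" for v
    by (rule Suc.IH[of "\<lambda>x. frechet_derivative f (at x) v"]) (use Suc.prems D in auto)
  ultimately show ?case by simp
qed

text \<open>The recursion in the definition goes through the operator \<open>frechet_derivative\<close>; this rule allows any
  explicitly known derivative to be used instead.\<close>

lemma Ck_on_SucI:
  fixes f :: "'a::euclidean_space \<Rightarrow> 'b::real_normed_vector"
  assumes "open S" and f: "\<And>x. x \<in> S \<Longrightarrow> (f has_derivative f' x) (at x)"
    and "\<And>v. Ck_on k S (\<lambda>x. f' x v)"
  shows "Ck_on (Suc k) S f"
proof -
  have D: "f' x = frechet_derivative f (at x)" if "x \<in> S" for x
    by (rule frechet_derivative_at[OF f[OF that]])
  have "f differentiable_on S"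
    unfolding differentiable_on_def using f differentiableI differentiable_at_withinI by blast
  moreover have "Ck_on k S (\<lambda>x. frechet_derivative f (at x) v)" for v
    by (rule Ck_on_cong[OF \<open>open S\<close> _ assms(3)[of v]]) (simp add: D)
  ultimately show ?thesis by simp
qed

lemma Ck_on_SucD: "Ck_on (Suc k) S f \<Longrightarrow> Ck_on k S f"
  by (induction k arbitrary: f) (auto simp: differentiable_imp_continuous_on)

lemma Ck_on_subset: "Ck_on k S f \<Longrightarrow> T \<subseteq> S \<Longrightarrow> Ck_on k T f"
  by (induction k arbitrary: f) (auto intro: continuous_on_subset differentiable_on_subset)

lemma Ck_on_const: "Ck_on k S (\<lambda>x. c)"
  by (induction k arbitrary: c) auto

lemma Ck_on_linear:
  fixes f :: "'a::euclidean_space \<Rightarrow> 'b::real_normed_vector"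
  assumes "bounded_linear L" "open S" "Ck_on k S f"
  shows "Ck_on k S (\<lambda>x. L (f x))"
  using assms(3)
proof (induction k arbitrary: f)
  case 0
  then show ?case using bounded_linear.continuous_on[OF assms(1)] by auto
next
  case (Suc k)
  show ?case
    by (rule Ck_on_SucI[OF \<open>open S\<close> bounded_linear.has_derivative[OF assms(1)
            Ck_on_Suc_has_derivative[OF \<open>open S\<close> Suc.prems]]])
      (use Suc in auto)
qed

lemma Ck_on_add:
  fixes f g :: "'a::euclidean_space \<Rightarrow> 'b::real_normed_vector"
  assumes "open S" "Ck_on k S f" "Ck_on k S g"
  shows "Ck_on k S (\<lambda>x. f x + g x)"
  using assms(2,3)
proof (induction k arbitrary: f g)
  case (Suc k)
  show ?case
    by (rule Ck_on_SucI[OF \<open>open S\<close> has_derivative_add[OF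
            Ck_on_Suc_has_derivative[OF \<open>open S\<close> Suc.prems(1)]
            Ck_on_Suc_has_derivative[OF \<open>open S\<close> Suc.prems(2)]]])
      (use Suc in auto)
qed (auto intro: continuous_on_add)

lemma Ck_on_mult:
  fixes f g :: "'a::euclidean_space \<Rightarrow> real"
  assumes "open S" "Ck_on k S f" "Ck_on k S g"
  shows "Ck_on k S (\<lambda>x. f x * g x)"
  using assms(2,3)
proof (induction k arbitrary: f g)
  case (Suc k)
  show ?case
  proof (rule Ck_on_SucI[OF \<open>open S\<close> has_derivative_mult[OF
            Ck_on_Suc_has_derivative[OF \<open>open S\<close> Suc.prems(1)]
            Ck_on_Suc_has_derivative[OF \<open>open S\<close> Suc.prems(2)]]])
    fix v
    show "Ck_on k S (\<lambda>x. f x * frechet_derivative g (at x) v + frechet_derivative f (at x) v * g x)"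
      using Suc.prems Ck_on_SucD[OF Suc.prems(1)] Ck_on_SucD[OF Suc.prems(2)]
      by (intro Ck_on_add[OF \<open>open S\<close>] Suc.IH) simp_all
  qed
qed (auto intro: continuous_on_mult)

lemma Ck_on_exp:
  fixes f :: "'a::euclidean_space \<Rightarrow> real"
  assumes "open S" "Ck_on k S f"
  shows "Ck_on k S (\<lambda>x. exp (f x))"
  using assms(2)
proof (induction k)
  case (Suc k)
  show ?case
  proof (rule Ck_on_SucI[OF \<open>open S\<close> has_derivative_exp[OF
            Ck_on_Suc_has_derivative[OF \<open>open S\<close> Suc.prems]]])
    fix v
    show "Ck_on k S (\<lambda>x. frechet_derivative f (at x) v * exp (f x))"
      using Suc Ck_on_SucD[OF Suc.prems] by (intro Ck_on_mult[OF \<open>open S\<close>]) auto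
  qed
qed (auto intro: continuous_on_exp)

section \<open>Tangent vectors as derivations\<close>

lemma chart_open_image:
  assumes "is_chart (U, x)" "open S"
  shows "open (x ` (U \<inter> S))"
proof -
  have "openin (top_of_set (x ` U)) (x ` (U \<inter> S))"
    by (rule homeomorphism_imp_open_map[of U "x ` U" x "inv_into U x"])
      (use assms in \<open>auto simp: is_chart_def openin_open\<close>)
  then show ?thesis
    using assms by (auto simp: is_chart_def dest: openin_open_trans)
qed

lemma chart_inj: "is_chart (U, x) \<Longrightarrow> p \<in> U \<Longrightarrow> inv_into U x (x p) = p"
  by (auto simp: is_chart_def homeomorphism_def)

locale manifold =
  fixes A :: "'g::topological_space chart set"
  assumes atlas: "smooth_atlas A"
begin

lemma chart: "(U, x) \<in> A \<Longrightarrow> is_chart (U, x)"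
  using atlas by (auto simp: smooth_atlas_def)

lemma smooth_fun_onI:
  assumes "\<And>U x k. (U, x) \<in> A \<Longrightarrow> open (x ` (U \<inter> S)) \<Longrightarrow> Ck_on k (x ` (U \<inter> S)) (\<lambda>s. f (inv_into U x s))"
    and "open S"
  shows "smooth_fun_on A S f"
  unfolding smooth_fun_on_def smooth_on_def
  using assms chart_open_image[OF chart] by (auto simp: o_def)

lemma smooth_fun_onD:
  assumes "smooth_fun_on A S f" "(U, x) \<in> A"
  shows "Ck_on k (x ` (U \<inter> S)) (\<lambda>s. f (inv_into U x s))"
  using assms unfolding smooth_fun_on_def smooth_on_def by (auto simp: o_def)

lemma smooth_fun_on_const: "open S \<Longrightarrow> smooth_fun_on A S (\<lambda>q. c)"
  by (intro smooth_fun_onI Ck_on_const)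

lemma smooth_fun_on_add:
  "open S \<Longrightarrow> smooth_fun_on A S f \<Longrightarrow> smooth_fun_on A S h \<Longrightarrow> smooth_fun_on A S (\<lambda>q. f q + h q)"
  by (rule smooth_fun_onI, rule Ck_on_add) (auto intro: smooth_fun_onD)

lemma smooth_fun_on_mult:
  "open S \<Longrightarrow> smooth_fun_on A S f \<Longrightarrow> smooth_fun_on A S h \<Longrightarrow> smooth_fun_on A S (\<lambda>q. f q * h q)"
  by (rule smooth_fun_onI, rule Ck_on_mult) (auto intro: smooth_fun_onD)

lemma smooth_fun_on_exp:
  "open S \<Longrightarrow> smooth_fun_on A S f \<Longrightarrow> smooth_fun_on A S (\<lambda>q. exp (f q))"
  by (rule smooth_fun_onI, rule Ck_on_exp) (auto intro: smooth_fun_onD)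

lemma smooth_fun_on_cmult: "open S \<Longrightarrow> smooth_fun_on A S f \<Longrightarrow> smooth_fun_on A S (\<lambda>q. c * f q)"
  by (rule smooth_fun_on_mult[OF _ smooth_fun_on_const])

lemma smooth_fun_on_sum:
  assumes "open S" "finite I" "\<And>i. i \<in> I \<Longrightarrow> smooth_fun_on A S (f i)"
  shows "smooth_fun_on A S (\<lambda>q. \<Sum>i\<in>I. f i q)"
  using assms(2,3)
  by (induction I rule: finite_induct) (simp_all add: assms(1) smooth_fun_on_const smooth_fun_on_add)

lemma smooth_fun_on_cong:
  assumes "open S" "smooth_fun_on A S f" "\<And>q. q \<in> S \<Longrightarrow> f q = h q"
  shows "smooth_fun_on A S h"
proof (rule smooth_fun_onI[OF _ \<open>open S\<close>])
  fix U x k assume c: "(U, x) \<in> A" "open (x ` (U \<inter> S))"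
  show "Ck_on k (x ` (U \<inter> S)) (\<lambda>s. h (inv_into U x s))"
    by (rule Ck_on_cong[OF c(2) _ smooth_fun_onD[OF assms(2) c(1)]])
      (use assms(3) chart_inj[OF chart[OF c(1)]] in auto)
qed

lemma smooth_fun_on_subset:
  assumes "smooth_fun_on A S f" "T \<subseteq> S" "open T"
  shows "smooth_fun_on A T f"
  by (rule smooth_fun_onI[OF _ \<open>open T\<close>], rule Ck_on_subset[OF smooth_fun_onD[OF assms(1)]])
    (use assms(2) in auto)

lemma smooth_nearI: "open S \<Longrightarrow> p \<in> S \<Longrightarrow> smooth_fun_on A S f \<Longrightarrow> smooth_near A p f"
  by (auto simp: smooth_near_def)

lemma smooth_near_pair:
  assumes "smooth_near A p f" "smooth_near A p h"
  obtains S where "open S" "p \<in> S" "smooth_fun_on A S f" "smooth_fun_on A S h"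
proof -
  obtain S T where "open S" "p \<in> S" "smooth_fun_on A S f" "open T" "p \<in> T" "smooth_fun_on A T h"
    using assms by (auto simp: smooth_near_def)
  then show ?thesis
    by (intro that[of "S \<inter> T"]) (auto intro: smooth_fun_on_subset)
qed

lemma smooth_near_add:
  "smooth_near A p f \<Longrightarrow> smooth_near A p h \<Longrightarrow> smooth_near A p (\<lambda>q. f q + h q)"
  by (erule (1) smooth_near_pair) (rule smooth_nearI[OF _ _ smooth_fun_on_add])

lemma smooth_near_mult:
  "smooth_near A p f \<Longrightarrow> smooth_near A p h \<Longrightarrow> smooth_near A p (\<lambda>q. f q * h q)"
  by (erule (1) smooth_near_pair) (rule smooth_nearI[OF _ _ smooth_fun_on_mult])

lemma smooth_near_const: "smooth_near A p (\<lambda>q. c)"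
  by (rule smooth_nearI[OF open_UNIV UNIV_I smooth_fun_on_const[OF open_UNIV]])

lemma smooth_near_has_derivative:
  assumes "smooth_near A p f" "(U, x) \<in> A" "p \<in> U"
  shows "((\<lambda>s. f (inv_into U x s)) has_derivative
           frechet_derivative (\<lambda>s. f (inv_into U x s)) (at (x p))) (at (x p))"
proof -
  obtain S where S: "open S" "p \<in> S" "smooth_fun_on A S f"
    using assms(1) by (auto simp: smooth_near_def)
  show ?thesis
    by (rule Ck_on_Suc_has_derivative[OF chart_open_image[OF chart[OF assms(2)] S(1)]
          smooth_fun_onD[OF S(3) assms(2), of "Suc 0"]])
      (use S assms in auto)
qed

definition directional :: "'g set \<Rightarrow> ('g \<Rightarrow> real ^ 4) \<Rightarrow> 'g \<Rightarrow> real ^ 4 \<Rightarrow> 'g tvec" where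
  "directional U x p w = (\<lambda>f. if smooth_near A p f
     then frechet_derivative (\<lambda>s. f (inv_into U x s)) (at (x p)) w else 0)"

lemma tangent_space_iff:
  "v \<in> tangent_space A p \<longleftrightarrow> (\<exists>U x w. (U, x) \<in> A \<and> p \<in> U \<and> v = directional U x p w)"
  unfolding tangent_space_def directional_def o_def by (simp add: Bex_def split_paired_Ex)

text \<open>The chain rule for the transition map shows that every chart around a point yields all tangent
  vectors at that point.\<close>

lemma tangent_space_chart:
  assumes "v \<in> tangent_space A p" "(U, x) \<in> A" "p \<in> U"
  obtains w where "v = directional U x p w"
proof -
  obtain V y w where V: "(V, y) \<in> A" "p \<in> V" and v: "v = directional V y p w"
    using assms(1) by (auto simp: tangent_space_iff)
  note cU = chart[OF assms(2)] and cV = chart[OF V(1)]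
  let ?t = "\<lambda>s. x (inv_into V y s)"
  have "open U" using cU by (auto simp: is_chart_def)
  have op: "open (y ` (V \<inter> U))" by (rule chart_open_image[OF cV \<open>open U\<close>])
  have "smooth_transition (V, y) (U, x)"
    using atlas V(1) assms(2) by (simp add: smooth_atlas_def)
  then have "Ck_on (Suc 0) (y ` (V \<inter> U)) ?t"
    by (simp only: smooth_transition_def smooth_on_def o_def prod.case)
  then have t: "(?t has_derivative frechet_derivative ?t (at (y p))) (at (y p))"
    by (rule Ck_on_Suc_has_derivative[OF op]) (use V assms in auto)
  have tp: "?t (y p) = x p" using chart_inj[OF cV V(2)] by simp
  show ?thesis
  proof (rule that[of "frechet_derivative ?t (at (y p)) w"], rule ext)
    fix f
    show "v f = directional U x p (frechet_derivative ?t (at (y p)) w) f"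
    proof (cases "smooth_near A p f")
      case True
      have "((\<lambda>s. f (inv_into U x (?t s))) has_derivative
              (\<lambda>w. frechet_derivative (\<lambda>s. f (inv_into U x s)) (at (x p))
                 (frechet_derivative ?t (at (y p)) w))) (at (y p))"
        using diff_chain_at[OF t, of "\<lambda>s. f (inv_into U x s)"]
          smooth_near_has_derivative[OF True assms(2,3)] tp by (simp add: o_def)
      then have "((\<lambda>s. f (inv_into V y s)) has_derivative
              (\<lambda>w. frechet_derivative (\<lambda>s. f (inv_into U x s)) (at (x p))
                 (frechet_derivative ?t (at (y p)) w))) (at (y p))"
        by (rule has_derivative_transform_within_open[OF _ op])
          (use V assms chart_inj[OF cV] chart_inj[OF cU] in auto)
      from frechet_derivative_at[OF this] show ?thesis
        using True by (simp add: v directional_def) metis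
    qed (simp add: v directional_def)
  qed
qed

lemma chart_at: obtains U x where "(U, x) \<in> A" "p \<in> U"
proof -
  have "p \<in> \<Union> (fst ` A)" using atlas by (simp add: smooth_atlas_def)
  then show ?thesis using that by auto
qed

lemma tangent_space_comb:
  assumes "u \<in> tangent_space A p" "v \<in> tangent_space A p"
  shows "(\<lambda>f. a * u f + b * v f) \<in> tangent_space A p"
proof -
  obtain U x where c: "(U, x) \<in> A" "p \<in> U" by (rule chart_at)
  obtain w1 where u: "u = directional U x p w1"
    by (rule tangent_space_chart[OF assms(1) c])
  obtain w2 where v: "v = directional U x p w2"
    by (rule tangent_space_chart[OF assms(2) c])
  have "(\<lambda>f. a * u f + b * v f) = directional U x p (a *\<^sub>R w1 + b *\<^sub>R w2)"
  proof
    fix f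
    show "a * u f + b * v f = directional U x p (a *\<^sub>R w1 + b *\<^sub>R w2) f"
    proof (cases "smooth_near A p f")
      case True
      have "linear (frechet_derivative (\<lambda>s. f (inv_into U x s)) (at (x p)))"
        using smooth_near_has_derivative[OF True c] has_derivative_linear by blast
      then show ?thesis using True by (simp add: u v directional_def linear_add linear_scale)
    qed (simp add: u v directional_def)
  qed
  then show ?thesis using c tangent_space_iff by blast
qed

text \<open>A tangent vector is a derivation on germs of smooth functions. The rules below are all read off
  from one chart, in which the tangent vector is an honest directional derivative.\<close>

context
  fixes v p assumes v: "v \<in> tangent_space A p"
begin

lemma tangent_not_smooth: "\<not> smooth_near A p f \<Longrightarrow> v f = 0"
  using v by (auto simp: tangent_space_iff directional_def)

lemma tangent_has_derivative:
  "\<exists>U x w. (U, x) \<in> A \<and> p \<in> U \<and> (\<forall>f D. smooth_near A p f \<longrightarrow>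
     ((\<lambda>s. f (inv_into U x s)) has_derivative D) (at (x p)) \<longrightarrow> v f = D w)"
proof -
  obtain U x w where c: "(U, x) \<in> A" "p \<in> U" and w: "v = directional U x p w"
    using v tangent_space_iff by blast
  have "v f = D w" if "smooth_near A p f" "((\<lambda>s. f (inv_into U x s)) has_derivative D) (at (x p))" for f D
    using frechet_derivative_at[OF that(2)] that(1) by (simp add: w directional_def)
  then show ?thesis using c by blast
qed

lemma tangent_const: "v (\<lambda>q. c) = 0"
proof -
  obtain U x w where c: "(U, x) \<in> A" "p \<in> U"
    "\<And>f D. smooth_near A p f \<Longrightarrow> ((\<lambda>s. f (inv_into U x s)) has_derivative D) (at (x p)) \<Longrightarrow> v f = D w"
    using tangent_has_derivative by blast
  show ?thesis by (rule c(3)[OF smooth_near_const has_derivative_const])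
qed

lemma tangent_add:
  assumes "smooth_near A p f" "smooth_near A p h"
  shows "v (\<lambda>q. f q + h q) = v f + v h"
proof -
  obtain U x w where c: "(U, x) \<in> A" "p \<in> U"
    "\<And>f D. smooth_near A p f \<Longrightarrow> ((\<lambda>s. f (inv_into U x s)) has_derivative D) (at (x p)) \<Longrightarrow> v f = D w"
    using tangent_has_derivative by blast
  note d = smooth_near_has_derivative[OF assms(1) c(1,2)] smooth_near_has_derivative[OF assms(2) c(1,2)]
  show ?thesis
    using c(3)[OF smooth_near_add[OF assms] has_derivative_add[OF d]]
      c(3)[OF assms(1) d(1)] c(3)[OF assms(2) d(2)] by simp
qed

lemma tangent_mult:
  assumes "smooth_near A p f" "smooth_near A p h"
  shows "v (\<lambda>q. f q * h q) = f p * v h + v f * h p"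
proof -
  obtain U x w where c: "(U, x) \<in> A" "p \<in> U"
    "\<And>f D. smooth_near A p f \<Longrightarrow> ((\<lambda>s. f (inv_into U x s)) has_derivative D) (at (x p)) \<Longrightarrow> v f = D w"
    using tangent_has_derivative by blast
  note d = smooth_near_has_derivative[OF assms(1) c(1,2)] smooth_near_has_derivative[OF assms(2) c(1,2)]
  show ?thesis
    using c(3)[OF smooth_near_mult[OF assms] has_derivative_mult[OF d]]
      c(3)[OF assms(1) d(1)] c(3)[OF assms(2) d(2)] chart_inj[OF chart[OF c(1)] c(2)] by simp
qed

lemma tangent_exp:
  assumes "smooth_near A p f"
  shows "v (\<lambda>q. exp (f q)) = exp (f p) * v f"
proof -
  obtain U x w where c: "(U, x) \<in> A" "p \<in> U"
    "\<And>f D. smooth_near A p f \<Longrightarrow> ((\<lambda>s. f (inv_into U x s)) has_derivative D) (at (x p)) \<Longrightarrow> v f = D w"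
    using tangent_has_derivative by blast
  note d = smooth_near_has_derivative[OF assms(1) c(1,2)]
  have "smooth_near A p (\<lambda>q. exp (f q))"
    using assms smooth_fun_on_exp unfolding smooth_near_def by blast
  then show ?thesis
    using c(3)[OF _ has_derivative_exp[OF d]]
      c(3)[OF assms(1) d(1)] chart_inj[OF chart[OF c(1)] c(2)] by simp
qed

lemma tangent_cmult: "smooth_near A p f \<Longrightarrow> v (\<lambda>q. c * f q) = c * v f"
  using tangent_mult[OF smooth_near_const] tangent_const by simp

lemma tangent_sum:
  "finite I \<Longrightarrow> (\<And>i. i \<in> I \<Longrightarrow> smooth_near A p (f i)) \<Longrightarrow>
    smooth_near A p (\<lambda>q. \<Sum>i\<in>I. f i q) \<and> v (\<lambda>q. \<Sum>i\<in>I. f i q) = (\<Sum>i\<in>I. v (f i))"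
  by (induction I rule: finite_induct)
    (auto simp: tangent_const smooth_near_const tangent_add intro!: smooth_near_add)

text \<open>Needed because the equations for the flat coordinates hold only on their domain, whereas
  left-invariant fields act on total functions.\<close>

lemma tangent_local:
  assumes "open S" "p \<in> S" "smooth_near A p f" "\<And>q. q \<in> S \<Longrightarrow> f q = h q"
  shows "v f = v h"
proof -
  obtain U x w where c: "(U, x) \<in> A" "p \<in> U"
    "\<And>f D. smooth_near A p f \<Longrightarrow> ((\<lambda>s. f (inv_into U x s)) has_derivative D) (at (x p)) \<Longrightarrow> v f = D w"
    using tangent_has_derivative by blast
  obtain T where T: "open T" "p \<in> T" "smooth_fun_on A T f"
    using assms(3) by (auto simp: smooth_near_def)
  have "smooth_fun_on A (S \<inter> T) h"
    by (rule smooth_fun_on_cong[OF _ smooth_fun_on_subset[OF T(3)]]) (use assms T in auto)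
  then have h: "smooth_near A p h"
    by (rule smooth_nearI[rotated 2]) (use assms T in auto)
  note d = smooth_near_has_derivative[OF assms(3) c(1,2)]
  have "((\<lambda>s. h (inv_into U x s)) has_derivative
           frechet_derivative (\<lambda>s. f (inv_into U x s)) (at (x p))) (at (x p))"
    by (rule has_derivative_transform_within_open[OF d chart_open_image[OF chart[OF c(1)] \<open>open S\<close>]])
      (use assms c chart_inj[OF chart[OF c(1)]] in auto)
  then show ?thesis using c(3)[OF assms(3) d] c(3)[OF h] by simp
qed

end

end

section \<open>Curvature of a metric Lie algebra\<close>

text \<open>\<open>N a b\<close> stands for the covariant derivative of \<open>b\<close> along \<open>a\<close>. As the connection is
  torsion-free, the Lie bracket is \<open>N a b - N b a\<close> and needs no constant of its own; its Jacobi
  identity is the first Bianchi identity for \<open>curv\<close>.\<close>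

locale metric_algebra =
  fixes B :: "'a::real_vector \<Rightarrow> 'a \<Rightarrow> real" and N :: "'a \<Rightarrow> 'a \<Rightarrow> 'a"
  assumes B_sym: "B a b = B b a"
    and B_add: "B (a + b) c = B a c + B b c"
    and B_scale: "B (r *\<^sub>R a) c = r * B a c"
    and B_nondeg: "(\<And>b. B a b = 0) \<Longrightarrow> a = 0"
    and N_add: "N (a + b) c = N a c + N b c" "N c (a + b) = N c a + N c b"
    and N_scale: "N (r *\<^sub>R a) c = r *\<^sub>R N a c" "N c (r *\<^sub>R a) = r *\<^sub>R N c a"
    and N_skew: "B (N a b) c = - B b (N a c)"
begin

lemma B_add': "B c (a + b) = B c a + B c b"
  by (metis B_add B_sym)

lemma B_scale': "B c (r *\<^sub>R a) = r * B c a"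
  by (metis B_scale B_sym)

lemma B_minus: "B (- a) c = - B a c" "B c (- a) = - B c a"
  using B_scale[of "-1"] B_scale'[of _ "-1"] by auto

lemma B_diff: "B (a - b) c = B a c - B b c" "B c (a - b) = B c a - B c b"
  using B_add[of a "-b"] B_add'[of c a "-b"] B_minus by auto

lemma B_zero: "B 0 c = 0" "B c 0 = 0"
  using B_scale[of 0] B_scale'[of _ 0] by auto

lemma N_minus: "N (- a) c = - N a c" "N c (- a) = - N c a"
  using N_scale(1)[of "-1"] N_scale(2)[of _ "-1"] by auto

lemma N_diff: "N (a - b) c = N a c - N b c" "N c (a - b) = N c a - N c b"
  using N_add(1)[of a "-b"] N_add(2)[of c a "-b"] N_minus by auto

lemma N_zero: "N 0 c = 0" "N c 0 = 0"
  using N_scale(1)[of 0] N_scale(2)[of _ 0] by auto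

lemmas B_lin = B_add B_add' B_scale B_scale' B_minus B_diff B_zero
lemmas N_lin = N_add N_scale N_minus N_diff N_zero

definition curv :: "'a \<Rightarrow> 'a \<Rightarrow> 'a \<Rightarrow> 'a" where
  "curv a b c = N a (N b c) - N b (N a c) - N (N a b - N b a) c"

lemma eqI_B: "(\<And>d. B a d = B b d) \<Longrightarrow> a = b"
  using B_nondeg[of "a - b"] by (auto simp: B_lin)

text \<open>The commutators of the maps \<open>N a\<close> cancel by their own Jacobi identity; what remains is \<open>N\<close> of the
  Jacobi sum of the bracket.\<close>

lemma second_bianchi:
  assumes "\<And>a b c. curv a b c + curv b c a + curv c a b = 0"
  defines "D \<equiv> \<lambda>a b c d. N a (curv b c d) - curv (N a b) c d - curv b (N a c) d - curv b c (N a d)"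
  shows "D a b c d + D b c a d + D c a b d = 0"
proof -
  have "N (curv a b c + curv b c a + curv c a b) d = 0"
    by (simp add: assms N_lin)
  then show ?thesis
    unfolding D_def curv_def by (simp add: N_lin algebra_simps)
qed

text \<open>The Koszul argument for the flat metric \<open>\<psi> B\<close>, where \<open>\<psi> = exp (- 2 \<sigma>)\<close> and \<open>s = d\<sigma>\<close>: \<open>U b c d\<close> is its
  product of \<open>\<nabla>'\<^sub>b c\<close> and \<open>d\<close>, with \<open>\<nabla>'\<close> its Levi-Civita connection. The result is the usual rule for the
  change of connection under a conformal change of metric.\<close>

lemma conformal_koszul:
  fixes U :: "'a \<Rightarrow> 'a \<Rightarrow> 'a \<Rightarrow> real" and s :: "'a \<Rightarrow> real"
  assumes torsion: "\<And>b c d. U b c d - U c b d = \<psi> * B (N b c - N c b) d"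
    and metric: "\<And>b c d. U b c d + U b d c = - 2 * s b * (\<psi> * B c d)"
  shows "U b c d = \<psi> * (B (N b c) d - s b * B c d - s c * B b d + s d * B b c)"
proof -
  have *: "\<psi> * B (N b c) d = - (\<psi> * B (N b d) c)" for b c d
    using N_skew[of b c d] B_sym[of c] by simp
  have "2 * U b c d = (U b c d + U b d c) + (U c b d + U c d b) - (U d b c + U d c b)
      + (U b c d - U c b d) + (U c d b - U d c b) * (- 1) + (U d b c - U b d c)"
    by simp
  also have "\<dots> = 2 * (\<psi> * (B (N b c) d - s b * B c d - s c * B b d + s d * B b c))"
    unfolding metric torsion
    using *[of b c d] *[of c b d] *[of d b c] B_sym[of c b] B_sym[of d b] B_sym[of d c]
    by (simp add: B_lin algebra_simps)
  finally show ?thesis by simp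
qed

text \<open>The integrability condition of the preceding formula. All values are taken at one point: \<open>s2 a b\<close>
  is the derivative along \<open>a\<close> of the derivative of \<open>\<sigma>\<close> along \<open>b\<close>, \<open>H\<close> is the gradient of \<open>\<sigma>\<close>, \<open>M b c d\<close>
  is \<open>B (\<nabla>'\<^sub>b c) d\<close> for the flat connection \<open>\<nabla>'\<close>, \<open>M'\<close> is the derivative of \<open>M\<close>, and \<open>G b c\<close> is \<open>\<nabla>'\<^sub>b c\<close>
  itself. The form \<open>p\<close> is the Schouten tensor \<open>- \<nabla>d\<sigma> - d\<sigma> \<otimes> d\<sigma> + |d\<sigma>|\<^sup>2 g / 2\<close> of \<open>exp (2 \<sigma>)\<close> times a
  flat metric, so the conclusion says that the Weyl tensor vanishes.\<close>

lemma conformal_curvature: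
  fixes s :: "'a \<Rightarrow> real" and s2 :: "'a \<Rightarrow> 'a \<Rightarrow> real" and H :: 'a
  assumes H: "\<And>x. B H x = s x"
    and comm: "\<And>a b. s2 a b - s2 b a = s (N a b - N b a)"
  defines "M \<equiv> \<lambda>b c d. B (N b c) d - s b * B c d - s c * B b d + s d * B b c"
    and "M' \<equiv> \<lambda>a b c d. - s2 a b * B c d - s2 a c * B b d + s2 a d * B b c"
    and "G \<equiv> \<lambda>b c. N b c - s b *\<^sub>R c - s c *\<^sub>R b + B b c *\<^sub>R H"
    and "p \<equiv> \<lambda>a b. - s2 a b + s (N a b) - s a * s b + s H / 2 * B a b"
  assumes int: "M (N a b - N b a) c d = - 2 * s a * M b c d + 2 * s b * M a c d
      + M' a b c d - M' b a c d - M a d (G b c) + M b d (G a c)"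
  shows "B (curv a b c) d = B b c * p a d + p b c * B a d - B a c * p b d - p a c * B b d"
proof -
  have s_lin: "s (x + y) = s x + s y" "s (x - y) = s x - s y" "s (r *\<^sub>R x) = r * s x" for x y r
    by (simp_all add: H[symmetric] B_lin)
  have BH: "B x H = s x" for x using H B_sym by metis
  have sN: "s (N x y) = - B (N x H) y" for x y
    using N_skew[of x H y] H by simp
  have sk: "B (N x y) z = - B (N x z) y" for x y z
    using N_skew[of x y z] B_sym[of y] by simp
  have skN: "B (N a d) (N b c) = - B d (N a (N b c))" "B (N b d) (N a c) = - B d (N b (N a c))"
    by (simp_all add: N_skew)
  have sk': "B y (N x z) = - B (N x y) z" for x y z
    by (simp add: N_skew)
  have e1: "s2 b a = s2 a b - s (N a b) + s (N b a)" using comm[of a b] by (simp add: s_lin)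
  show ?thesis
    using int unfolding M_def M'_def G_def p_def curv_def e1
    by (simp add: s_lin B_lin N_lin BH H)
     (simp add: skN B_sym[of d] B_sym[of c b] B_sym[of c a] B_sym[of b a] sk[of _ d] sk'[of b] sk'[of a] algebra_simps)
qed

end

section \<open>Vanishing Weyl tensor and the Codazzi equation\<close>

text \<open>The Weyl tensor vanishes and \<open>P\<close> is the Schouten operator.\<close>

locale conformally_flat_algebra = metric_algebra +
  fixes P
  assumes P_sym: "B (P a) b = B a (P b)"
    and curv_eq: "curv a b c = B b c *\<^sub>R P a + B (P b) c *\<^sub>R a - B a c *\<^sub>R P b - B (P a) c *\<^sub>R b"
begin

lemma P_lin: "P (a + b) = P a + P b" "P (r *\<^sub>R a) = r *\<^sub>R P a" "P (a - b) = P a - P b" "P 0 = 0" "P (- a) = - P a"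
  by (rule eqI_B, simp add: P_sym B_lin)+

lemma first_bianchi: "curv a b c + curv b c a + curv c a b = 0"
  unfolding curv_eq using B_sym P_sym by (simp add: algebra_simps)

text \<open>\<open>(\<nabla>\<^sub>a P) b - (\<nabla>\<^sub>b P) a\<close>.\<close>

definition cotton :: "'a \<Rightarrow> 'a \<Rightarrow> 'a" where
  "cotton a b = N a (P b) - P (N a b) - (N b (P a) - P (N b a))"

lemma cotton_bianchi:
  "B c d *\<^sub>R cotton a b + B a d *\<^sub>R cotton b c + B b d *\<^sub>R cotton c a =
   B (cotton a b) d *\<^sub>R c + B (cotton b c) d *\<^sub>R a + B (cotton c a) d *\<^sub>R b"
proof -
  note * = second_bianchi[OF first_bianchi, of a b c d]
  have 1: "B x (N y z) = - B (N y x) z" for x y z by (simp add: N_skew)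
  show ?thesis
    using * unfolding curv_eq cotton_def by (simp add: N_lin P_lin B_lin 1 P_sym scaleR_add_left scaleR_add_right scaleR_diff_left scaleR_diff_right) (simp add: algebra_simps)
qed

lemma cotton_antisym: "cotton a b = - cotton b a"
  by (simp add: cotton_def)

text \<open>The contraction of \<open>cotton_bianchi\<close>, done by hand on a basis. It needs four basis vectors: an index
  distinct from three given ones must exist. Choosing \<open>c\<close> and \<open>d\<close> dual to each other isolates one
  component of the Cotton tensor: either it is zero, or it changes sign whenever the repeated index is
  replaced by another one, which among three indices is only possible for zero.\<close>

lemma cotton_zero_component:
  fixes e d :: "4 \<Rightarrow> 'a"
  assumes dual: "\<And>i j. B (e i) (d j) = (if i = j then 1 else 0)"
  shows "B (cotton (e i) (e j)) (d l) = 0"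
proof -
  define F where "F i j l = B (cotton (e i) (e j)) (d l)" for i j l
  have anti: "F i j l = - F j i l" for i j l
    unfolding F_def by (subst cotton_antisym) (simp add: B_lin)
  have fresh: "\<exists>k. k \<notin> {i, j, l}" for i j l :: 4
  proof (rule ccontr)
    assume "\<not> (\<exists>k. k \<notin> {i, j, l})"
    then have "UNIV = {i, j, l}" by auto
    moreover have "card {i, j, l} \<le> 3"
      using card_length[of "[i, j, l]"] by simp
    ultimately have "CARD(4) \<le> 3" by metis
    then show False by simp
  qed
  define \<delta> :: "4 \<Rightarrow> 4 \<Rightarrow> real" where "\<delta> i j = (if i = j then 1 else 0)" for i j
  have dual': "B (e i) (d j) = \<delta> i j" for i j
    by (simp add: dual \<delta>_def)
  have id: "\<delta> k m * F i j l + \<delta> i m * F j k l + \<delta> j m * F k i l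
      = F i j m * \<delta> k l + F j k m * \<delta> i l + F k i m * \<delta> j l" for i j k l m
    using arg_cong[OF cotton_bianchi[of "e k" "d m" "e i" "e j"], of "\<lambda>x. B x (d l)"]
    by (simp add: B_lin dual' F_def)
  have off: "F i j l = 0" if "i \<noteq> j" "l \<noteq> i" "l \<noteq> j" for i j l
  proof -
    obtain k where "k \<notin> {i, j, l}" using fresh by blast
    then have "\<delta> k k = 1" "\<delta> i k = 0" "\<delta> j k = 0" "\<delta> k l = 0" "\<delta> i l = 0" "\<delta> j l = 0"
      using that by (auto simp: \<delta>_def)
    then show ?thesis using id[of k k i j l] by simp
  qed
  have swap: "F i j i = - F k j k" if "i \<noteq> j" "k \<noteq> i" "k \<noteq> j" for i j k
  proof -
    have "\<delta> k k = 1" "\<delta> i k = 0" "\<delta> j k = 0" "\<delta> k i = 0" "\<delta> i i = 1" "\<delta> j i = 0"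
      using that by (auto simp: \<delta>_def)
    then have "F i j i = F j k k" using id[of k k i j i] by simp
    then show ?thesis using anti[of j k k] by linarith
  qed
  have diag: "F i j i = 0" if "i \<noteq> j" for i j
  proof -
    obtain k where k: "k \<notin> {i, j, j}" using fresh by blast
    obtain m where "m \<notin> {i, j, k}" using fresh by blast
    then have "F i j i = - F k j k" "F k j k = - F m j m" "F i j i = - F m j m"
      using k that by (blast intro: swap)+
    then show ?thesis by linarith
  qed
  have "F i j l = 0"
  proof (cases "i = j")
    case True
    then show ?thesis using anti[of i i l] by simp
  next
    case False
    then show ?thesis
      using off[of i j l] diag[of i j] diag[of j i] anti[of i j j] by (metis add.inverse_neutral)
  qed
  then show ?thesis by (simp add: F_def)
qed

end

section \<open>Invariant null subspaces\<close>

locale conformally_flat_algebra4 = conformally_flat_algebra B N P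
  for B :: "'a::euclidean_space \<Rightarrow> 'a \<Rightarrow> real" and N P +
  assumes dim4: "DIM('a) = 4"
begin

definition walker :: "'a set \<Rightarrow> bool" where
  "walker D \<longleftrightarrow> subspace D \<and> D \<noteq> {0} \<and> dim D \<le> 2 \<and> (\<forall>x\<in>D. \<forall>y\<in>D. B x y = 0) \<and> (\<forall>a. \<forall>x\<in>D. N a x \<in> D)"

lemma walker_curv:
  assumes "walker D" "x \<in> D"
  shows "curv a b x \<in> D"
  using assms unfolding curv_def walker_def by (auto intro!: subspace_diff)

text \<open>For \<open>x\<close> and \<open>y\<close> in \<open>D\<close>, invariance of \<open>D\<close> under \<open>curv x b\<close> puts \<open>B b y P x - B (P x) y b\<close> into \<open>D\<close> for
  every \<open>b\<close>. If \<open>B (P x) y\<close> were not zero, \<open>P x\<close> and \<open>D\<close> would span the whole space, whose dimension is 4.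
  So the second term drops out, and a \<open>b\<close> that is not orthogonal to \<open>y\<close> gives the claim.\<close>

lemma walker_P:
  assumes D: "walker D" and x: "x \<in> D"
  shows "P x \<in> D"
proof -
  have sub: "subspace D" and null: "\<And>x y. x \<in> D \<Longrightarrow> y \<in> D \<Longrightarrow> B x y = 0" and "dim D \<le> 2"
    using D by (auto simp: walker_def)
  obtain z where z: "z \<in> D" "z \<noteq> 0"
    using D subspace_0[OF sub] unfolding walker_def by blast
  have key: "B b y *\<^sub>R P x - B (P x) y *\<^sub>R b \<in> D" if "y \<in> D" for b y
  proof -
    have "curv x b y - B (P b) y *\<^sub>R x \<in> D"
      using walker_curv[OF D that] x sub by (auto intro: subspace_diff subspace_scale)
    then show ?thesis
      unfolding curv_eq using null[OF x that] by (simp add: algebra_simps)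
  qed
  have 0: "B (P x) y = 0" if y: "y \<in> D" for y
  proof (rule ccontr)
    assume nz: "B (P x) y \<noteq> 0"
    have "b \<in> span (insert (P x) D)" for b
    proof -
      have "B b y *\<^sub>R P x - (B b y *\<^sub>R P x - B (P x) y *\<^sub>R b) \<in> span (insert (P x) D)"
        by (intro span_diff[OF span_scale[OF span_base] span_base])
          (simp_all add: key[OF y, of b])
      moreover have "B b y *\<^sub>R P x - (B b y *\<^sub>R P x - B (P x) y *\<^sub>R b) = B (P x) y *\<^sub>R b"
        by simp
      ultimately have "inverse (B (P x) y) *\<^sub>R (B (P x) y *\<^sub>R b) \<in> span (insert (P x) D)"
        using span_scale by metis
      then show ?thesis using nz by simp
    qed
    then have "span (insert (P x) D) = UNIV" by auto
    then have "dim (insert (P x) D) = 4" by (metis dim4 dim_span dim_UNIV)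
    moreover have "dim (insert (P x) D) \<le> 3" using \<open>dim D \<le> 2\<close> by (simp add: dim_insert)
    ultimately show False by simp
  qed
  obtain b where b: "B b z \<noteq> 0" using B_nondeg[of z] z B_sym by metis
  have "B b z *\<^sub>R P x \<in> D" using key[OF z(1), of b] 0[OF z(1)] by simp
  then show ?thesis using b subspace_scale[OF sub, of "B b z *\<^sub>R P x" "inverse (B b z)"] by simp
qed

lemma walker_curv_perp:
  assumes "walker D" "x \<in> D" "\<And>y. y \<in> D \<Longrightarrow> B y w = 0"
  shows "B b x * B (P a) w + B (P b) x * B a w - B a x * B (P b) w - B (P a) x * B b w = 0"
  using assms(3)[OF walker_curv[OF assms(1,2), of a b]] by (simp add: curv_eq B_lin)

end

section \<open>Segre type [1,(12)]\<close>

text \<open>\<open>e0\<close> belongs to the simple eigenvalue, \<open>e1\<close> to the block of size 1 and \<open>e2, e3\<close> to the block of size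
  2 of the other eigenvalue.\<close>

locale jordan_1_12 = conformally_flat_algebra4 +
  fixes e0 e1 e2 e3 and l1 l2 :: real
  assumes basis: "\<exists>c0 c1 c2 c3. x = c0 *\<^sub>R e0 + c1 *\<^sub>R e1 + c2 *\<^sub>R e2 + c3 *\<^sub>R e3"
    and l: "l1 \<noteq> l2"
    and pos: "B e0 e0 > 0"
    and P: "P e0 = l1 *\<^sub>R e0" "P e1 = l2 *\<^sub>R e1" "P e2 = l2 *\<^sub>R e2" "P e3 = l2 *\<^sub>R e3 + e2"
    and ind: "\<And>a b. a *\<^sub>R e1 + b *\<^sub>R e2 = 0 \<Longrightarrow> a = 0 \<and> b = 0"
begin

lemma orth: "B e0 e1 = 0" "B e0 e2 = 0" "B e0 e3 = 0" "B e1 e2 = 0" "B e2 e2 = 0"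
  and orth_sym: "B e1 e0 = 0" "B e2 e0 = 0" "B e3 e0 = 0" "B e2 e1 = 0"
proof -
  show 1: "B e0 e1 = 0" using P_sym[of e0 e1] l by (simp add: P B_lin)
  show 2: "B e0 e2 = 0" using P_sym[of e0 e2] l by (simp add: P B_lin)
  show 3: "B e0 e3 = 0" using P_sym[of e0 e3] l 2 by (simp add: P B_lin)
  show 4: "B e1 e2 = 0" using P_sym[of e1 e3] by (simp add: P B_lin)
  show "B e2 e2 = 0" using P_sym[of e2 e3] by (simp add: P B_lin)
  show "B e1 e0 = 0" "B e2 e0 = 0" "B e3 e0 = 0" "B e2 e1 = 0"
    using 1 2 3 4 B_sym by metis+
qed

lemma B_e2_e3: "B e2 e3 \<noteq> 0"
proof
  have nz: "e2 \<noteq> 0" using ind[of 0 1] by auto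
  assume *: "B e2 e3 = 0"
  have "B e2 x = 0" for x
    using basis[of x] orth orth_sym * by (auto simp: B_lin)
  then show False using B_nondeg nz by blast
qed

lemma B_e1_e1: "B e1 e1 \<noteq> 0"
proof
  assume *: "B e1 e1 = 0"
  let ?y = "B e2 e3 *\<^sub>R e1 + (- B e1 e3) *\<^sub>R e2"
  have "B ?y x = 0" for x
    using basis[of x] orth orth_sym * by (auto simp: B_lin)
  then have "?y = 0" by (rule B_nondeg)
  then show False using ind B_e2_e3 by blast
qed

lemma no_walker: "\<not> walker D"
proof
  assume D: "walker D"
  then have sub: "subspace D" and null: "\<And>x y. x \<in> D \<Longrightarrow> y \<in> D \<Longrightarrow> B x y = 0"
    by (auto simp: walker_def)
  obtain z where z: "z \<in> D" "z \<noteq> 0"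
    using D subspace_0[OF sub] unfolding walker_def by blast
  have perp: "B x e0 = 0" if x: "x \<in> D" for x
  proof -
    obtain c0 c1 c2 c3 where c: "x = c0 *\<^sub>R e0 + c1 *\<^sub>R e1 + c2 *\<^sub>R e2 + c3 *\<^sub>R e3" using basis by blast
    have 1: "P x - l2 *\<^sub>R x \<in> D" if "x \<in> D" for x
      by (intro subspace_diff[OF sub] subspace_scale[OF sub] walker_P[OF D] that)
    \<comment> \<open>\<open>P - l2\<close> is nilpotent of order 2 on \<open>e1, e2, e3\<close>, so its square isolates the component along \<open>e0\<close>,
      which cannot be null.\<close>
    have 2: "P x - l2 *\<^sub>R x = ((l1 - l2) * c0) *\<^sub>R e0 + c3 *\<^sub>R e2"
      by (simp add: c P P_lin algebra_simps)
    have "P (P x - l2 *\<^sub>R x) - l2 *\<^sub>R (P x - l2 *\<^sub>R x) \<in> D" by (intro 1 x)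
    moreover have "P (P x - l2 *\<^sub>R x) - l2 *\<^sub>R (P x - l2 *\<^sub>R x) = ((l1 - l2)^2 * c0) *\<^sub>R e0"
      unfolding 2 by (simp add: P P_lin algebra_simps) (simp add: power2_eq_square algebra_simps flip: scaleR_add_left scaleR_diff_left)
    ultimately have "((l1 - l2)^2 * c0)^2 * B e0 e0 = 0"
      using null by (fastforce simp: B_lin power2_eq_square)
    then have "c0 = 0" using l pos by simp
    then show ?thesis using c orth orth_sym by (simp add: B_lin)
  qed
  \<comment> \<open>\<open>curv e0 b x\<close> is orthogonal to \<open>e0\<close>, for every \<open>b\<close>.\<close>
  have eig: "P x = - l1 *\<^sub>R x" if x: "x \<in> D" for x
  proof -
    have "B (P x + l1 *\<^sub>R x) b = 0" for b
    proof -
      have "B x b * (l1 * B e0 e0) + B (P x) b * B e0 e0 = 0"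
        using walker_curv_perp[OF D x perp, of b e0] perp[OF x]
        by (simp add: P B_lin P_sym B_sym[of b x] B_sym[of b "P x"] B_sym[of e0 x])
      then have "(l1 * B x b + B (P x) b) * B e0 e0 = 0" by (simp add: algebra_simps)
      then show ?thesis using pos by (simp add: B_lin)
    qed
    then have "P x + l1 *\<^sub>R x = 0" by (rule B_nondeg)
    then show ?thesis by (simp add: eq_neg_iff_add_eq_0)
  qed
  have *: "l1 + l2 = 0 \<and> (\<exists>c. x = c *\<^sub>R e2)" if x: "x \<in> D" "x \<noteq> 0" for x
  proof -
    obtain c0 c1 c2 c3 where c: "x = c0 *\<^sub>R e0 + c1 *\<^sub>R e1 + c2 *\<^sub>R e2 + c3 *\<^sub>R e3" using basis by blast
    have "c0 = 0" using perp[OF x(1)] orth orth_sym pos by (auto simp: c B_lin)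
    have e: "B (P x) b + l1 * B x b = 0" for b using eig[OF x(1)] by (simp add: B_lin)
    have b2: "(l1 + l2) * c3 = 0"
    proof -
      have "(l1 + l2) * c3 * B e2 e3 = 0"
        using e[of e2] \<open>c0 = 0\<close> orth B_sym[of e3 e2] by (simp add: c P P_lin B_lin algebra_simps)
      then show ?thesis using B_e2_e3 by simp
    qed
    have b1: "(l1 + l2) * c1 = 0"
    proof -
      have "(l1 + l2) * c1 * B e1 e1 + (l1 + l2) * c3 * B e1 e3 = 0"
        using e[of e1] \<open>c0 = 0\<close> orth B_sym[of e3 e1] orth_sym by (simp add: c P P_lin B_lin algebra_simps)
      then show ?thesis using B_e1_e1 b2 by simp
    qed
    have b3: "(l1 + l2) * c2 + c3 = 0"
    proof -
      have "((l1 + l2) * c2 + c3) * B e2 e3 + (l1 + l2) * c1 * B e1 e3 + (l1 + l2) * c3 * B e3 e3 = 0"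
        using e[of e3] \<open>c0 = 0\<close> orth by (simp add: c P P_lin B_lin algebra_simps)
      then show ?thesis using B_e2_e3 b1 b2 by simp
    qed
    have l0: "l1 + l2 = 0" using b1 b2 b3 x \<open>c0 = 0\<close> c by auto
    then have "c3 = 0" using b3 by simp
    have "c1 = 0"
      using null[OF x(1) x(1)] \<open>c0 = 0\<close> \<open>c3 = 0\<close> orth B_e1_e1 orth_sym by (simp add: c B_lin)
    then show ?thesis using c \<open>c0 = 0\<close> \<open>c3 = 0\<close> l0 by auto
  qed
  obtain c where c: "z = c *\<^sub>R e2" using * z by blast
  have De: "B x e1 = 0" if "x \<in> D" for x
    using *[OF that] orth orth_sym by (cases "x = 0") (auto simp: B_lin)
  \<comment> \<open>As \<open>D\<close> is the line of \<open>e2\<close>, also \<open>e1\<close> is orthogonal to it, and \<open>B (curv e1 e3 e2) e1\<close> must vanish.\<close>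
  have "2 * l2 * c * B e2 e3 * B e1 e1 = 0"
    using walker_curv_perp[OF D z(1) De, of e3 e1] orth orth_sym B_sym[of e3 e2]
    by (auto simp: c P B_lin)
  then have "l2 = 0" using B_e2_e3 B_e1_e1 c z by auto
  then show False using *[OF z] l by simp
qed

end

section \<open>Segre type [(1,3)]\<close>

locale jordan_13 = conformally_flat_algebra4 +
  fixes e0 e1 e2 e3 and l :: real
  assumes basis: "\<exists>c0 c1 c2 c3. x = c0 *\<^sub>R e0 + c1 *\<^sub>R e1 + c2 *\<^sub>R e2 + c3 *\<^sub>R e3"
    and nz: "e1 \<noteq> 0"
    and pos: "B e0 e0 > 0"
    and P: "P e0 = l *\<^sub>R e0" "P e1 = l *\<^sub>R e1" "P e2 = l *\<^sub>R e2 + e1" "P e3 = l *\<^sub>R e3 + e2"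
    and orth: "B e0 e1 = 0" "B e0 e2 = 0" "B e0 e3 = 0"
begin

lemma gram: "B e1 e1 = 0" "B e1 e2 = 0" "B e2 e2 = B e1 e3" "B e1 e3 \<noteq> 0"
proof -
  show 1: "B e1 e1 = 0" using P_sym[of e1 e2] by (simp add: P B_lin)
  show 2: "B e1 e2 = 0" using P_sym[of e1 e3] by (simp add: P B_lin)
  show "B e2 e2 = B e1 e3" using P_sym[of e2 e3] by (simp add: P B_lin)
  show "B e1 e3 \<noteq> 0"
  proof
    assume *: "B e1 e3 = 0"
    have "B e1 e0 = 0" using orth B_sym by metis
    then have "B e1 x = 0" for x
      using basis[of x] 1 2 * by (auto simp: B_lin)
    then show False using B_nondeg nz by blast
  qed
qed

end

text \<open>Adding to \<open>e2\<close> and \<open>e3\<close> earlier members of the chain preserves the Jordan form and makes the Gram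
  matrix antidiagonal on the chain, so that up to scaling \<open>e3, e2, e1\<close> is the dual basis of \<open>e1, e2, e3\<close>.\<close>

locale normalized_jordan_13 = jordan_13 +
  assumes norm: "B e2 e3 = 0" "B e3 e3 = 0"
begin

abbreviation "\<kappa> \<equiv> B e0 e0"
abbreviation "\<delta> \<equiv> B e1 e3"

lemma gram_all:
  "B e0 e1 = 0" "B e0 e2 = 0" "B e0 e3 = 0" "B e1 e0 = 0" "B e2 e0 = 0" "B e3 e0 = 0"
  "B e1 e1 = 0" "B e1 e2 = 0" "B e2 e1 = 0" "B e2 e2 = \<delta>" "B e3 e1 = \<delta>"
  "B e2 e3 = 0" "B e3 e2 = 0" "B e3 e3 = 0"
  using orth gram norm B_sym[of e1 e0] B_sym[of e2 e0] B_sym[of e3 e0] B_sym[of e2 e1] B_sym[of e3 e1] B_sym[of e3 e2]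
  by simp_all

lemma expand:
  "x = (B x e0 / \<kappa>) *\<^sub>R e0 + (B x e3 / \<delta>) *\<^sub>R e1 + (B x e2 / \<delta>) *\<^sub>R e2 + (B x e1 / \<delta>) *\<^sub>R e3"
proof -
  obtain c0 c1 c2 c3 where c: "x = c0 *\<^sub>R e0 + c1 *\<^sub>R e1 + c2 *\<^sub>R e2 + c3 *\<^sub>R e3"
    using basis by blast
  then have "B x e0 = c0 * \<kappa>" "B x e3 = c1 * \<delta>" "B x e2 = c2 * \<delta>" "B x e1 = c3 * \<delta>"
    by (simp_all add: B_lin gram_all)
  then have "B x e0 / \<kappa> = c0" "B x e3 / \<delta> = c1" "B x e2 / \<delta> = c2" "B x e1 / \<delta> = c3"
    using pos gram(4) by simp_all
  then show ?thesis using c by metis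
qed

lemma B_expand:
  "B x y = B x e0 * B y e0 / \<kappa> + (B x e1 * B y e3 + B x e2 * B y e2 + B x e3 * B y e1) / \<delta>"
proof -
  have "B x y = B x ((B y e0 / \<kappa>) *\<^sub>R e0 + (B y e3 / \<delta>) *\<^sub>R e1 + (B y e2 / \<delta>) *\<^sub>R e2 + (B y e1 / \<delta>) *\<^sub>R e3)"
    by (rule arg_cong[OF expand])
  then show ?thesis by (simp only: B_lin) (simp add: add_divide_distrib algebra_simps)
qed

text \<open>The nilpotent part of \<open>P\<close> moves any vector of \<open>D\<close> down the Jordan chain to \<open>e1\<close>, unless it lies in the
  kernel, where \<open>e1\<close> spans the only null line. Hence \<open>e1 \<in> D\<close>. A null vector orthogonal to \<open>e1\<close> has its
  components along \<open>e0\<close> and \<open>e2\<close> either both zero or both different from zero. So either \<open>D\<close> is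
  orthogonal to both \<open>e0\<close> and \<open>e2\<close> (case \<open>\<beta> = 0\<close>), or \<open>D\<close> contains a vector \<open>\<alpha> e0 + \<beta> e2\<close>, and is orthogonal
  to it because \<open>D\<close> is null.\<close>

lemma walker_cases:
  assumes D: "walker D"
  obtains \<alpha> \<beta> where "e1 \<in> D" "\<alpha> \<noteq> 0" "\<And>y. y \<in> D \<Longrightarrow> B y (\<alpha> *\<^sub>R e0 + \<beta> *\<^sub>R e2) = 0"
    "\<And>y. y \<in> D \<Longrightarrow> \<beta> = 0 \<Longrightarrow> B y e2 = 0"
proof -
  have sub: "subspace D" and null: "\<And>x y. x \<in> D \<Longrightarrow> y \<in> D \<Longrightarrow> B x y = 0"
    using D by (auto simp: walker_def)
  obtain z where z: "z \<in> D" "z \<noteq> 0"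
    using D subspace_0[OF sub] unfolding walker_def by blast
  obtain c0 c1 c2 c3 where c: "z = c0 *\<^sub>R e0 + c1 *\<^sub>R e1 + c2 *\<^sub>R e2 + c3 *\<^sub>R e3"
    using basis by blast
  have n: "P x - l *\<^sub>R x \<in> D" if "x \<in> D" for x
    by (intro subspace_diff[OF sub] subspace_scale[OF sub] walker_P[OF D] that)
  have scale: "e1 \<in> D" if "c *\<^sub>R e1 \<in> D" "c \<noteq> 0" for c
    using subspace_scale[OF sub that(1), of "inverse c"] that by simp
  have n1: "P z - l *\<^sub>R z = c2 *\<^sub>R e1 + c3 *\<^sub>R e2"
    by (simp add: c P P_lin algebra_simps)
  have n2: "P (c2 *\<^sub>R e1 + c3 *\<^sub>R e2) - l *\<^sub>R (c2 *\<^sub>R e1 + c3 *\<^sub>R e2) = c3 *\<^sub>R e1"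
    by (simp add: P P_lin algebra_simps)
  have e1: "e1 \<in> D"
  proof (cases "c3 = 0")
    case False
    moreover have "c3 *\<^sub>R e1 \<in> D" using n[OF n[OF z(1)]] unfolding n1 n2 .
    ultimately show ?thesis by (intro scale[of c3])
  next
    case c3: True
    show ?thesis
    proof (cases "c2 = 0")
      case False
      then show ?thesis using n[OF z(1)] n1 c3 by (intro scale[of c2]) simp_all
    next
      case True
      then have "c0 = 0" using null[OF z(1) z(1)] pos c3 by (simp add: c B_lin gram_all)
      then have "z = c1 *\<^sub>R e1" using c c3 True by simp
      then show ?thesis using z by (intro scale[of c1]) auto
    qed
  qed
  have y1: "B y e1 = 0" if "y \<in> D" for y using null that e1 by blast
  have yn: "(B y e0)^2 / \<kappa> + (B y e2)^2 / \<delta> = 0" if "y \<in> D" for y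
    using B_expand[of y y] null[OF that that] y1[OF that] by (simp add: power2_eq_square)
  show ?thesis
  proof (cases "\<forall>y\<in>D. B y e0 = 0")
    case True
    then have 2: "B y e2 = 0" if "y \<in> D" for y
      using yn[OF that] that gram(4) by simp
    show ?thesis
      by (rule that[of 1 0]) (use e1 True 2 in \<open>auto simp: B_lin\<close>)
  next
    case False
    then obtain y where y: "y \<in> D" "B y e0 \<noteq> 0" by blast
    then have "B y e2 \<noteq> 0" using yn[OF y(1)] pos by auto
    have "B x ((B y e0 / \<kappa>) *\<^sub>R e0 + (B y e2 / \<delta>) *\<^sub>R e2) = 0" if "x \<in> D" for x
      using B_expand[of x y] null[OF that y(1)] y1[OF that] y1[OF y(1)]
      by (simp add: B_lin mult.commute)
    then show ?thesis
      by (rule that[of "B y e0 / \<kappa>" "B y e2 / \<delta>", rotated 2])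
        (use e1 y pos \<open>B y e2 \<noteq> 0\<close> gram(4) in auto)
  qed
qed

text \<open>Evaluate the curvature on \<open>e1\<close> and \<open>w = \<alpha> e0 + \<beta> e2\<close> from \<open>walker_cases\<close>: \<open>B (curv e0 e3 e1) w\<close> is a
  multiple of the eigenvalue and must vanish.\<close>

lemma walker_eigenvalue:
  assumes D: "walker D"
  shows "l = 0"
proof -
  obtain \<alpha> \<beta> where w: "e1 \<in> D" "\<alpha> \<noteq> 0" "\<And>y. y \<in> D \<Longrightarrow> B y (\<alpha> *\<^sub>R e0 + \<beta> *\<^sub>R e2) = 0"
    "\<And>y. y \<in> D \<Longrightarrow> \<beta> = 0 \<Longrightarrow> B y e2 = 0"
    by (rule walker_cases[OF D]) blast
  have "2 * l * \<alpha> * \<kappa> * \<delta> = 0"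
    using walker_curv_perp[OF D w(1) w(3), of e3 e0] by (simp add: P B_lin gram_all algebra_simps)
  then show ?thesis using w pos gram(4) by simp
qed

lemma cotton_eq_0:
  assumes "a \<in> {e0, e1, e2, e3}" "b \<in> {e0, e1, e2, e3}" "c \<in> {e0, e1, e2, e3}"
  shows "B (cotton a b) c = 0"
proof -
  define e :: "4 \<Rightarrow> 'a" where "e i = (if i = 1 then e1 else if i = 2 then e2 else if i = 3 then e3 else e0)" for i
  define d :: "4 \<Rightarrow> 'a" where "d i = (if i = 1 then (1/\<delta>) *\<^sub>R e3 else if i = 2 then (1/\<delta>) *\<^sub>R e2
     else if i = 3 then (1/\<delta>) *\<^sub>R e1 else (1/\<kappa>) *\<^sub>R e0)" for i
  have dual: "B (e i) (d j) = (if i = j then 1 else 0)" for i j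
    using exhaust_4[of i] exhaust_4[of j] pos gram(4)
    by (elim disjE) (simp_all add: e_def d_def B_lin gram_all)
  have "range e = {e0, e1, e2, e3}"
    unfolding UNIV_4 by (auto simp: e_def)
  then obtain i j where ij: "a = e i" "b = e j" using assms(1,2) by (metis rangeE)
  have z: "B (cotton a b) (d k) = 0" for k
    unfolding ij by (rule cotton_zero_component[OF dual])
  show ?thesis
    using z[of 1] z[of 2] z[of 3] z[of 4] assms(3) pos gram(4)
    by (auto simp: d_def B_lin)
qed

text \<open>For nilpotent \<open>P\<close>, the tensor \<open>B ((\<nabla>\<^sub>a P) b) c\<close> is symmetric in all its arguments, while skewness of
  \<open>N a\<close> kills many of its components. What these linear equations say about \<open>N\<close> is found by elimination.
  In particular, up to \<open>B (N e3 e1) e3\<close> all \<open>B (N e\<^sub>i e1) e\<^sub>j\<close> are given by the two numbers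
  \<open>B (N e3 e1) e0\<close> and \<open>B (N e3 e1) e2\<close>.\<close>

lemma codazzi:
  assumes "l = 0"
  shows "B (N e0 e1) e0 = 0" "B (N e1 e1) e0 = 0" "B (N e2 e1) e0 = 0"
    and "B (N e0 e1) e2 = 0" "B (N e1 e1) e2 = 0" "B (N e2 e1) e2 = 0"
    and "B (N e0 e2) e0 = 0" "B (N e1 e2) e0 = 0" "B (N e2 e2) e0 = B (N e3 e1) e0"
    and "B (N e0 e1) e3 = B (N e3 e1) e0" "B (N e1 e1) e3 = 0" "B (N e2 e1) e3 = 2 * B (N e3 e1) e2"
proof -
  note P0 = P[unfolded assms(1) scaleR_zero_left add_0]
  have sk: "B (N k i) j = - B (N k j) i" for k i j
    using N_skew[of k i j] B_sym[of i] by simp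
  have ct: "B (N a (P b)) c - B (N a b) (P c) - B (N b (P a)) c + B (N b a) (P c) = 0"
    if "a \<in> {e0, e1, e2, e3}" "b \<in> {e0, e1, e2, e3}" "c \<in> {e0, e1, e2, e3}" for a b c
    using cotton_eq_0[OF that] unfolding cotton_def by (simp add: B_lin P_sym)
  note eqs = ct[of e1 e0 e0]
    ct[of e1 e0 e1]
    ct[of e1 e0 e2]
    ct[of e1 e0 e3]
    ct[of e2 e0 e0]
    ct[of e2 e0 e1]
    ct[of e2 e0 e2]
    ct[of e2 e0 e3]
    ct[of e2 e1 e0]
    ct[of e2 e1 e1]
    ct[of e2 e1 e2]
    ct[of e2 e1 e3]
    ct[of e3 e0 e0]
    ct[of e3 e0 e1]
    ct[of e3 e0 e2]
    ct[of e3 e0 e3]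
    ct[of e3 e1 e0]
    ct[of e3 e1 e1]
    ct[of e3 e1 e2]
    ct[of e3 e1 e3]
    ct[of e3 e2 e0]
    ct[of e3 e2 e1]
    ct[of e3 e2 e2]
    ct[of e3 e2 e3]
  note eqs' = eqs[unfolded P0 B_lin N_lin, simplified]
  have sk': "B (N k e1) e1 = 0" "B (N k e2) e2 = 0" "B (N k e3) e3 = 0" "B (N k e0) e0 = 0"
    "B (N k e0) e1 = - B (N k e1) e0" "B (N k e0) e2 = - B (N k e2) e0" "B (N k e0) e3 = - B (N k e3) e0"
    "B (N k e2) e1 = - B (N k e1) e2" "B (N k e3) e1 = - B (N k e1) e3" "B (N k e3) e2 = - B (N k e2) e3" for k
    using sk[of k] by (smt (verit))+
  note sks = sk'[of e0] sk'[of e1] sk'[of e2] sk'[of e3]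
  show "B (N e0 e1) e0 = 0"
    using eqs' sks by linarith
  show "B (N e1 e1) e0 = 0"
    using eqs' sks by linarith
  show "B (N e2 e1) e0 = 0"
    using eqs' sks by linarith
  show "B (N e0 e1) e2 = 0"
    using eqs' sks by linarith
  show "B (N e1 e1) e2 = 0"
    using eqs' sks by linarith
  show "B (N e2 e1) e2 = 0"
    using eqs' sks by linarith
  show "B (N e0 e2) e0 = 0"
    using eqs' sks by linarith
  show "B (N e1 e2) e0 = 0"
    using eqs' sks by linarith
  show "B (N e2 e2) e0 = B (N e3 e1) e0"
    using eqs' sks by linarith
  show "B (N e0 e1) e3 = B (N e3 e1) e0"
    using eqs' sks by linarith
  show "B (N e1 e1) e3 = 0"
    using eqs' sks by linarith
  show "B (N e2 e1) e3 = 2 * B (N e3 e1) e2"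
    using eqs' sks by linarith
qed

lemma no_walker: "\<not> walker D"
proof
  assume D: "walker D"
  note l0 = walker_eigenvalue[OF D]
  note P0 = P[unfolded l0 scaleR_zero_left add_0]
  note cod = codazzi[OF l0]
  obtain \<alpha> \<beta> where w: "e1 \<in> D" "\<alpha> \<noteq> 0" "\<And>y. y \<in> D \<Longrightarrow> B y (\<alpha> *\<^sub>R e0 + \<beta> *\<^sub>R e2) = 0"
    "\<And>y. y \<in> D \<Longrightarrow> \<beta> = 0 \<Longrightarrow> B y e2 = 0"
    by (rule walker_cases[OF D]) blast
  have sk: "B (N k i) j = - B (N k j) i" for k i j
    using N_skew[of k i j] B_sym[of i] by simp
  have sk0: "B (N k i) i = 0" for k i
    using sk[of k i i] by simp
  have N_expand: "B (N x i) j = B x e0 / \<kappa> * B (N e0 i) j + B x e3 / \<delta> * B (N e1 i) j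
      + B x e2 / \<delta> * B (N e2 i) j + B x e1 / \<delta> * B (N e3 i) j" for x i j
  proof -
    have "B (N x i) j = B (N ((B x e0 / \<kappa>) *\<^sub>R e0 + (B x e3 / \<delta>) *\<^sub>R e1 + (B x e2 / \<delta>) *\<^sub>R e2
        + (B x e1 / \<delta>) *\<^sub>R e3) i) j"
      by (rule arg_cong[OF expand])
    then show ?thesis by (simp only: B_lin N_lin)
  qed
  have curv: "B (curv a b c) d = B (N a c) (N b d) - B (N b c) (N a d) - B (N (N a b - N b a) c) d" for a b c d
    unfolding curv_def B_lin using N_skew[of a "N b c" d] N_skew[of b "N a c" d] by simp
  \<comment> \<open>\<open>B (curv e0 e3 e1) e0\<close> vanishes by the form of the curvature, and only one term of its expression by
    \<open>N\<close> survives: a square.\<close>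
  have "B (N e0 e3 - N e3 e0) e1 = 0"
    using cod sk[of e0 e3 e1] sk[of e3 e0 e1] by (simp add: B_lin)
  then have "B (N (N e0 e3 - N e3 e0) e1) e0 = 0"
    by (subst N_expand) (simp add: cod)
  moreover have "B (N e3 e1) (N e0 e0) = 0"
    using cod sk[of e0 e0 e1] sk[of e0 e0 e2] by (subst B_expand) (simp add: sk0)
  moreover have "B (N e0 e1) (N e3 e0) = - (B (N e3 e1) e0)\<^sup>2 / \<delta>"
    using sk[of e3 e0 e1] by (subst B_expand) (simp add: sk0 cod power2_eq_square)
  moreover have "B (curv e0 e3 e1) e0 = 0"
    by (simp add: curv_eq B_lin P0 gram_all)
  ultimately have p: "B (N e3 e1) e0 = 0"
    using curv[of e0 e3 e1 e0] gram(4) by simp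
  \<comment> \<open>The Walker condition relates this component to the one along \<open>e2\<close>.\<close>
  have "N e3 e1 \<in> D" using D w(1) by (auto simp: walker_def)
  then have t: "B (N e3 e1) e2 = 0"
    using w(3)[of "N e3 e1"] w(4)[of "N e3 e1"] p by (cases "\<beta> = 0") (auto simp: B_lin)
  have N2: "B (N e2 e1) x = 0" for x
    by (subst B_expand) (simp add: cod t sk0)
  \<comment> \<open>Now every term in \<open>B (curv e2 e3 e1) e3\<close> vanishes, although the form of the curvature gives \<open>\<delta>\<^sup>2\<close>.\<close>
  have "B (N e2 e3 - N e3 e2) e1 = 0"
    using sk[of e2 e3 e1] sk[of e3 e2 e1] by (simp add: B_lin N2 t)
  then have "B (N (N e2 e3 - N e3 e2) e1) e3 = 0"
    by (subst N_expand) (simp add: cod p t)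
  moreover have "B (N e3 e1) (N e2 e3) = 0"
    using sk[of e2 e3 e1] by (subst B_expand) (simp add: sk0 p t N2)
  moreover have "B (curv e2 e3 e1) e3 = \<delta> * \<delta>"
    by (simp add: curv_eq B_lin P0 gram_all)
  ultimately show False
    using curv[of e2 e3 e1 e3] N2 gram(4) by simp
qed

end

context jordan_13
begin

lemma no_walker: "\<not> walker D"
proof -
  define a where "a = - B e2 e3 / (2 * B e1 e3)"
  define b where "b = - (B e3 e3 + a * a * B e1 e3 + 2 * a * B e2 e3) / (2 * B e1 e3)"
  define e2' where "e2' = e2 + a *\<^sub>R e1"
  define e3' where "e3' = e3 + a *\<^sub>R e2 + b *\<^sub>R e1"
  have sym: "B e2 e1 = 0" "B e3 e1 = B e1 e3" "B e3 e2 = B e2 e3"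
    using gram B_sym[of e2 e1] B_sym[of e3 e1] B_sym[of e3 e2] by auto
  have a: "2 * a * B e1 e3 = - B e2 e3" and b: "2 * b * B e1 e3 = - (B e3 e3 + a * a * B e1 e3 + 2 * a * B e2 e3)"
    using gram(4) by (simp_all add: a_def b_def)
  interpret n: normalized_jordan_13 B N P e0 e1 e2' e3' l
  proof
    fix x
    obtain c0 c1 c2 c3 where c: "x = c0 *\<^sub>R e0 + c1 *\<^sub>R e1 + c2 *\<^sub>R e2 + c3 *\<^sub>R e3"
      using basis by blast
    have "x = c0 *\<^sub>R e0 + (c1 - c3 * b - (c2 - c3 * a) * a) *\<^sub>R e1 + (c2 - c3 * a) *\<^sub>R e2' + c3 *\<^sub>R e3'"
      unfolding c e2'_def e3'_def by (simp add: algebra_simps)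
    then show "\<exists>c0 c1 c2 c3. x = c0 *\<^sub>R e0 + c1 *\<^sub>R e1 + c2 *\<^sub>R e2' + c3 *\<^sub>R e3'" by blast
  next
    show "B e2' e3' = 0"
      unfolding e2'_def e3'_def using a by (simp add: B_lin gram sym algebra_simps)
    show "B e3' e3' = 0"
      unfolding e3'_def using a b by (simp add: B_lin gram sym algebra_simps)
  qed (use nz pos P orth in \<open>auto simp: e2'_def e3'_def P_lin B_lin algebra_simps\<close>)
  show ?thesis by (rule n.no_walker)
qed

end

section \<open>Left-invariant fields in coordinates\<close>

text \<open>The Lie algebra is identified with \<open>real ^ 4\<close> by a left-invariant frame \<open>V\<close>. The existence of
  pseudo-orthonormal bases is what bounds the dimension of the tangent spaces by 4.\<close>

locale metric_lie_group = manifold A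
  for A :: "'g::{topological_group_add, t2_space, second_countable_topology} chart set" +
  fixes g :: "'g metric" and nab :: "'g connection" and V :: "nat \<Rightarrow> 'g vfield"
  assumes metric: "left_invariant_metric A g"
    and lc: "levi_civita A g nab"
    and frame: "left_invariant_frame A 4 V"
    and onb: "\<And>p. \<exists>e. pseudo_orthonormal_basis A g p e"
begin

definition frame_index :: "4 \<Rightarrow> nat" where
  "frame_index i = (if i = 1 then 0 else if i = 2 then 1 else if i = 3 then 2 else 3)"

text \<open>The left-invariant field with coordinates \<open>c\<close>.\<close>

definition F :: "real ^ 4 \<Rightarrow> 'g vfield" where
  "F c = (\<lambda>p f. \<Sum>i\<in>UNIV. c $ i * V (frame_index i) p f)"

lemma F_4: "F c p f = c $ 1 * V 0 p f + c $ 2 * V 1 p f + c $ 3 * V 2 p f + c $ 4 * V 3 p f"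
  by (simp add: F_def sum_4 frame_index_def)

lemma V_left_invariant: "i < 4 \<Longrightarrow> left_invariant A (V i)"
  using frame by (simp add: left_invariant_frame_def)

lemma frame_index_less: "frame_index i < 4"
  by (simp add: frame_index_def)

lemma V_vector_field: "vector_field A (V (frame_index i))"
  using V_left_invariant[OF frame_index_less] by (simp add: left_invariant_def)

lemma F_add: "F (a + b) p f = F a p f + F b p f"
  by (simp add: F_def algebra_simps sum.distrib)

lemma F_scale: "F (r *\<^sub>R a) p f = r * F a p f"
  by (simp add: F_def algebra_simps sum_distrib_left)

lemma F_diff: "F (a - b) p f = F a p f - F b p f"
  by (simp add: F_def algebra_simps sum_subtractf)

lemma F_zero: "F 0 p f = 0"
  by (simp add: F_def)

lemma F_sum: "F (\<Sum>i\<in>I. k i *\<^sub>R a i) p f = (\<Sum>i\<in>I. k i * F (a i) p f)"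
  by (induction I rule: infinite_finite_induct) (simp_all add: F_zero F_add F_scale)

lemma F_tangent: "F c p \<in> tangent_space A p"
proof -
  have V: "V i p \<in> tangent_space A p" if "i < 4" for i
    using V_left_invariant[OF that] by (simp add: left_invariant_def vector_field_def)
  have "(\<lambda>f. 1 * (c $ 1 * V 0 p f + c $ 2 * V 1 p f) + 1 * (c $ 3 * V 2 p f + c $ 4 * V 3 p f))
      \<in> tangent_space A p"
    by (intro tangent_space_comb V) simp_all
  moreover have "F c p = (\<lambda>f. 1 * (c $ 1 * V 0 p f + c $ 2 * V 1 p f) + 1 * (c $ 3 * V 2 p f + c $ 4 * V 3 p f))"
    by (rule ext) (simp add: F_4)
  ultimately show ?thesis by simp
qed

lemma F_vector_field: "vector_field A (F c)"
proof -
  have "smooth_fun_on A U (\<lambda>p. F c p f)" if "open U" "smooth_fun_on A U f" for U f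
    unfolding F_def
    by (intro smooth_fun_on_sum smooth_fun_on_cmult)
      (use that V_vector_field in \<open>auto simp: vector_field_def\<close>)
  then show ?thesis using F_tangent by (auto simp: vector_field_def)
qed

lemma F_left_invariant: "left_invariant A (F c)"
proof -
  have V: "V (frame_index i) (a + p) = dL a (V (frame_index i) p)" for i a p
    using V_left_invariant[OF frame_index_less] by (simp add: left_invariant_def)
  have "F c (a + p) = dL a (F c p)" for a p
    unfolding F_def V by (simp add: dL_def)
  then show ?thesis using F_vector_field by (simp add: left_invariant_def)
qed

lemma F_translate: "F c (a + p) f = F c p (\<lambda>q. f (a + q))"
  using F_left_invariant by (simp add: left_invariant_def dL_def)

lemma F_inj:
  assumes "\<And>f. F c p f = 0"
  shows "c = 0"
proof -
  define k where "k j = (if j = 0 then c $ 1 else if j = 1 then c $ 2 else if j = 2 then c $ 3 else c $ 4)"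
    for j :: nat
  have "(\<Sum>i<4. k i * V i p f) = F c p f" for f
    by (simp add: F_4 k_def numeral_eq_Suc lessThan_Suc)
  then have "\<forall>f. (\<Sum>i<4. k i * V i p f) = 0"
    using assms by simp
  moreover have "\<forall>p c. (\<forall>f. (\<Sum>i<4. c i * V i p f) = 0) \<longrightarrow> (\<forall>i<4. c i = 0)"
    using frame unfolding left_invariant_frame_def by (rule conjunct2)
  ultimately have "\<forall>i<4. k i = 0" by blast
  then have "k 0 = 0" "k 1 = 0" "k 2 = 0" "k 3 = 0" by simp_all
  then show ?thesis
    by (simp add: k_def vec_eq_iff forall_4)
qed

lemma F_eqD: "(\<And>f. F a p f = F b p f) \<Longrightarrow> a = b"
  using F_inj[of "a - b" p] by (simp add: F_diff)

text \<open>The expansion of the fields \<open>F c\<close> in a pseudo-orthonormal basis is an injective linear map between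
  spaces of dimension 4, hence onto.\<close>

lemma F_surj:
  assumes "v \<in> tangent_space A p"
  obtains c where "v = F c p"
proof -
  obtain e where "pseudo_orthonormal_basis A g p e" using onb[of p] by (rule exE)
  then have e: "\<exists>c. v = (\<lambda>f. \<Sum>i\<in>UNIV. c i * e (i::4) f)" if "v \<in> tangent_space A p" for v
    unfolding pseudo_orthonormal_basis_def
    by (elim conjE) (rule bspec[OF _ that, where P = "\<lambda>v. \<exists>c. v = (\<lambda>f. \<Sum>i\<in>UNIV. c i * e i f)"])
  have "\<forall>i. \<exists>m. F (axis i 1) p = (\<lambda>f. \<Sum>j\<in>UNIV. m j * e j f)"
    by (intro allI e F_tangent)
  from choice[OF this] obtain m where m: "\<And>i. F (axis i 1) p = (\<lambda>f. \<Sum>j\<in>UNIV. m i j * e j f)"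
    by (elim exE) (rule that, erule spec)
  define L :: "real ^ 4 \<Rightarrow> real ^ 4" where "L c = (\<chi> j. \<Sum>i\<in>UNIV. c $ i * m i j)" for c
  have Le: "F c p f = (\<Sum>j\<in>UNIV. L c $ j * e j f)" for c f
  proof -
    have "F c p f = F (\<Sum>i\<in>UNIV. c $ i *\<^sub>R axis i 1) p f"
      using basis_expansion[of c] by (simp add: scalar_mult_eq_scaleR)
    also have "\<dots> = (\<Sum>i\<in>UNIV. c $ i * (\<Sum>j\<in>UNIV. m i j * e j f))"
      by (simp add: F_sum m)
    also have "\<dots> = (\<Sum>j\<in>UNIV. L c $ j * e j f)"
      unfolding L_def vec_lambda_beta sum_distrib_left sum_distrib_right mult.assoc by (rule sum.swap)
    finally show ?thesis .
  qed
  have lin: "linear L"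
    by (rule linearI) (simp_all add: L_def vec_eq_iff algebra_simps sum.distrib sum_distrib_left)
  have "inj L"
    unfolding linear_injective_0[OF lin]
  proof (intro allI impI)
    fix c assume "L c = 0"
    then show "c = 0" by (intro F_inj[of c p]) (simp add: Le)
  qed
  then have "surj L" using lin linear_injective_imp_surjective by blast
  obtain k where k: "v = (\<lambda>f. \<Sum>i\<in>UNIV. k i * e i f)" using e[OF assms] by (rule exE)
  obtain c where "L c = (\<chi> j. k j)" using \<open>surj L\<close> by (metis surjD)
  then have "v = F c p" by (intro ext) (simp add: k Le)
  then show ?thesis by (rule that)
qed

text \<open>A left-invariant field is determined by its value at the neutral element.\<close>

lemma left_invariant_F:
  assumes "left_invariant A X"
  obtains c where "X = F c"
proof -
  have "X 0 \<in> tangent_space A 0" using assms by (simp add: left_invariant_def vector_field_def)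
  then obtain c where c: "X 0 = F c 0" by (rule F_surj)
  have "X p = F c p" for p
  proof -
    have "X (p + 0) = dL p (X 0)" using assms unfolding left_invariant_def by blast
    moreover have "F c (p + 0) = dL p (F c 0)"
      using F_left_invariant unfolding left_invariant_def by blast
    ultimately show ?thesis using c by simp
  qed
  then have "X = F c" by (rule ext)
  then show ?thesis by (rule that)
qed

subsection \<open>The metric\<close>

definition B :: "real ^ 4 \<Rightarrow> real ^ 4 \<Rightarrow> real" where
  "B a b = g 0 (F a 0) (F b 0)"

lemma g_F: "g p (F a p) (F b p) = B a b"
proof -
  have "F c (p + 0) = dL p (F c 0)" for c
    using F_left_invariant unfolding left_invariant_def by blast
  moreover have "g (p + 0) (dL p (F a 0)) (dL p (F b 0)) = g 0 (F a 0) (F b 0)"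
    using metric F_tangent unfolding left_invariant_metric_def by blast
  ultimately show ?thesis by (simp add: B_def)
qed

lemma pr_metric: "pseudo_riemannian_metric A g"
  using metric by (simp add: left_invariant_metric_def)

lemmas pr_metric_unfolded = pr_metric[unfolded pseudo_riemannian_metric_def]

lemma B_sym: "B a b = B b a"
  unfolding B_def
  by (rule pr_metric_unfolded[THEN conjunct1, rule_format]) (rule F_tangent)+

lemma B_comb: "B (r *\<^sub>R a + t *\<^sub>R b) c = r * B a c + t * B b c"
proof -
  have *: "F (r *\<^sub>R a + t *\<^sub>R b) 0 = (\<lambda>f. r * F a 0 f + t * F b 0 f)"
    by (rule ext) (simp add: F_add F_scale)
  show ?thesis
    unfolding B_def *
    by (rule pr_metric_unfolded[THEN conjunct2, THEN conjunct1, rule_format]) (rule F_tangent)+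
qed

lemma B_nondeg:
  assumes "\<And>b. B a b = 0"
  shows "a = 0"
proof -
  have "g 0 (F a 0) v = 0" if v: "v \<in> tangent_space A 0" for v
  proof -
    obtain b where "v = F b 0" by (rule F_surj[OF v])
    then show ?thesis using assms by (simp add: B_def)
  qed
  then have "F a 0 = (\<lambda>f. 0)"
    using pr_metric_unfolded[THEN conjunct2, THEN conjunct2, THEN conjunct1, rule_format, OF F_tangent] by blast
  then show ?thesis using F_inj[of a 0] by simp
qed

subsection \<open>The connection\<close>

lemma F_const: "F a p (\<lambda>q. c) = 0"
  by (rule tangent_const[OF F_tangent])

lemma nab_vector_field: "vector_field A (nab (F a) (F b))"
  using lc F_vector_field by (auto simp: levi_civita_def affine_connection_def)

lemma torsion_free:
  "lie_bracket A (F a) (F b) = vdiff (nab (F a) (F b)) (nab (F b) (F a))"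
  using lc F_vector_field by (auto simp: levi_civita_def)

text \<open>A priori the coordinates of \<open>nab (F a) (F b)\<close> may vary from point to point; \<open>nab_F\<close> shows that
  they do not.\<close>

definition nab_at :: "'g \<Rightarrow> real ^ 4 \<Rightarrow> real ^ 4 \<Rightarrow> real ^ 4" where
  "nab_at p a b = (SOME c. nab (F a) (F b) p = F c p)"

lemma nab_at: "nab (F a) (F b) p = F (nab_at p a b) p"
proof -
  have "nab (F a) (F b) p \<in> tangent_space A p"
    using nab_vector_field unfolding vector_field_def by blast
  then have "\<exists>c. nab (F a) (F b) p = F c p" by (rule F_surj) (rule exI)
  then show ?thesis unfolding nab_at_def by (rule someI_ex)
qed

definition N :: "real ^ 4 \<Rightarrow> real ^ 4 \<Rightarrow> real ^ 4" where
  "N = nab_at 0"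

text \<open>The bracket of left-invariant fields is left-invariant. The definition of
  the bracket distinguishes whether \<open>f\<close> is smooth near \<open>p\<close>; if \<open>f\<close> or its translate is not smooth near the
  respective point, then every left-invariant field annihilates \<open>f\<close> at \<open>p\<close>, because a tangent vector is
  zero on functions that are not smooth.\<close>

lemma lie_bracket_F: "lie_bracket A (F a) (F b) = F (N a b - N b a)"
proof -
  define k where "k p = nab_at p a b - nab_at p b a" for p
  have k: "lie_bracket A (F a) (F b) p f = F (k p) p f" for p f
    by (simp add: torsion_free vdiff_def nab_at k_def F_diff)
  have "lie_bracket A (F a) (F b) p f = F (k 0) p f" for p f
  proof -
    have tr: "F c p f = F c 0 (\<lambda>q. f (p + q))" for c
      using F_translate[of c p 0 f] by simp
    consider "\<not> smooth_near A p f" | "\<not> smooth_near A 0 (\<lambda>q. f (p + q))"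
      | "smooth_near A p f" "smooth_near A 0 (\<lambda>q. f (p + q))" by blast
    then show ?thesis
    proof cases
      case 1
      then show ?thesis using tangent_not_smooth[OF F_tangent] by (simp add: lie_bracket_def)
    next
      case 2
      then show ?thesis using tangent_not_smooth[OF F_tangent] by (simp add: k tr)
    next
      case 3
      have "lie_bracket A (F a) (F b) p f = lie_bracket A (F a) (F b) 0 (\<lambda>q. f (p + q))"
        using 3 F_translate[of _ p 0] by (simp add: lie_bracket_def F_translate)
      then show ?thesis by (simp add: k tr)
    qed
  qed
  then have "lie_bracket A (F a) (F b) = F (k 0)" by (intro ext)
  then show ?thesis by (simp add: k_def N_def)
qed

text \<open>The Koszul formula, in which products of left-invariant fields have derivative zero, expresses the
  connection by the metric and the structure constants of the bracket.\<close>

lemma nab_F: "nab (F a) (F b) = F (N a b)"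
proof -
  define k where "k a b = N a b - N b a" for a b
  have tors: "nab_at p a b - nab_at p b a = k a b" for a b p
  proof (rule F_eqD)
    show "F (nab_at p a b - nab_at p b a) p f = F (k a b) p f" for f
      using torsion_free[of a b] by (simp add: k_def lie_bracket_F F_diff nab_at vdiff_def fun_eq_iff)
  qed
  have skew: "B (nab_at p a b) c + B b (nab_at p a c) = 0" for a b c p
  proof -
    have "F a p (\<lambda>q. g q (F b q) (F c q)) = g p (nab (F a) (F b) p) (F c p) + g p (F b p) (nab (F a) (F c) p)"
      using lc F_vector_field unfolding levi_civita_def by blast
    then show ?thesis by (simp add: g_F F_const nab_at)
  qed
  have B_diff: "B (x - y) z = B x z - B y z" for x y z
    using B_comb[of 1 x "-1" y z] by simp
  have koszul: "2 * B (nab_at p a b) c = B (k a b) c - B (k b c) a + B (k c a) b" for a b c p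
  proof -
    have "B (k a b) c = B (nab_at p a b) c - B (nab_at p b a) c" "B (k b c) a = B (nab_at p b c) a - B (nab_at p c b) a"
      "B (k c a) b = B (nab_at p c a) b - B (nab_at p a c) b"
      by (simp_all add: tors[of p, symmetric] B_diff)
    then show ?thesis
      using skew[of p a b c] skew[of p b c a] skew[of p c a b]
        B_sym[of b "nab_at p a c"] B_sym[of c "nab_at p b a"] B_sym[of a "nab_at p c b"] by linarith
  qed
  have const: "nab_at p a b = nab_at 0 a b" for p
  proof -
    have "B (nab_at p a b - nab_at 0 a b) c = 0" for c
      using koszul[of p a b c] koszul[of 0 a b c] by (simp add: B_diff)
    then have "nab_at p a b - nab_at 0 a b = 0" by (rule B_nondeg)
    then show ?thesis by simp
  qed
  show ?thesis unfolding N_def by (rule ext, unfold nab_at, rule arg_cong[OF const, of "\<lambda>x. F x p" for p])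
qed

lemma vadd_F: "vadd (F a) (F b) = F (a + b)"
  by (intro ext) (simp add: vadd_def F_add)

lemma vdiff_F: "vdiff (F a) (F b) = F (a - b)"
  by (intro ext) (simp add: vdiff_def F_diff)

lemma fscale_F: "fscale (\<lambda>p. r) (F a) = F (r *\<^sub>R a)"
  by (intro ext) (simp add: fscale_def F_scale)

lemma F_injective: "F a = F b \<longleftrightarrow> a = b"
  using F_eqD[of a 0 b] by auto

lemma metric_algebra: "metric_algebra B N"
proof
  have aff: "affine_connection A nab" using lc by (simp add: levi_civita_def)
  show "B (a + b) c = B a c + B b c" for a b c using B_comb[of 1 a 1 b c] by simp
  show "B (r *\<^sub>R a) c = r * B a c" for r a c using B_comb[of r a 0 a c] by simp
  have "F (N (a + b) c) = F (N a c + N b c)" "F (N c (a + b)) = F (N c a + N c b)" for a b c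
    using aff F_vector_field unfolding affine_connection_def
    by (auto simp flip: nab_F vadd_F)
  then show "N (a + b) c = N a c + N b c" "N c (a + b) = N c a + N c b" for a b c
    by (simp_all add: F_injective)
  have const: "smooth_fun_on A UNIV (\<lambda>p. r)" for r by (rule smooth_fun_on_const) simp
  have "F (N (r *\<^sub>R a) c) = F (r *\<^sub>R N a c)" for r a c
    using aff F_vector_field const unfolding affine_connection_def
    by (auto simp flip: nab_F fscale_F)
  then show "N (r *\<^sub>R a) c = r *\<^sub>R N a c" for r a c by (simp add: F_injective)
  have "nab (F c) (fscale (\<lambda>p. r) (F a)) = vadd (fscale (\<lambda>p. F c p (\<lambda>p. r)) (F a)) (fscale (\<lambda>p. r) (nab (F c) (F a)))" for r a c
    using aff F_vector_field const unfolding affine_connection_def by blast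
  then have "F (N c (r *\<^sub>R a)) = F (r *\<^sub>R N c a)" for r a c
    by (simp add: F_const nab_F fscale_F vadd_F)
  then show "N c (r *\<^sub>R a) = r *\<^sub>R N c a" for r a c by (simp add: F_injective)
  show "B (N a b) c = - B b (N a c)" for a b c
  proof -
    have "F a 0 (\<lambda>q. g q (F b q) (F c q)) = g 0 (nab (F a) (F b) 0) (F c 0) + g 0 (F b 0) (nab (F a) (F c) 0)"
      using lc F_vector_field unfolding levi_civita_def by blast
    then show ?thesis by (simp add: g_F F_const nab_F)
  qed
qed (use B_sym B_nondeg in auto)

sublocale metric_algebra B N
  by (rule metric_algebra)

lemma curvature_F: "curvature A nab (F a) (F b) (F c) = F (curv a b c)"
  by (simp add: curvature_def nab_F lie_bracket_F vdiff_F curv_def)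

section \<open>The Ricci tensor of a conformally flat metric\<close>

text \<open>A pseudo-orthonormal basis at the neutral element extends to a left-invariant frame that is
  pseudo-orthonormal everywhere, so the choice in \<open>some_frame\<close> is not vacuous.\<close>

lemma orthonormal_frame:
  "\<exists>b. (\<forall>i. some_frame A g i = F (b i)) \<and> (\<forall>i j. i \<noteq> j \<longrightarrow> B (b i) (b j) = 0) \<and>
     (\<forall>i. B (b i) (b i) \<in> {1, -1}) \<and> (\<forall>x. \<exists>c. x = (\<Sum>i\<in>UNIV. c i *\<^sub>R b i))"
proof -
  define ok where "ok E \<longleftrightarrow> (\<forall>i. left_invariant A (E i)) \<and> (\<forall>p. pseudo_orthonormal_basis A g p (\<lambda>i. E i p))"
    for E :: "4 \<Rightarrow> 'g vfield"
  obtain e where e: "pseudo_orthonormal_basis A g 0 e" using onb[of 0] by (rule exE)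
  note e' = e[unfolded pseudo_orthonormal_basis_def]
  have e1: "e i \<in> tangent_space A 0" for i using e'[THEN conjunct1] by (rule spec)
  have e2: "\<exists>c. v = (\<lambda>f. \<Sum>i\<in>UNIV. c i * e i f)" if "v \<in> tangent_space A 0" for v
    using e'[THEN conjunct2, THEN conjunct1] that by (rule bspec)
  have e3: "g 0 (e i) (e i) \<in> {1, -1}" for i
    using e'[THEN conjunct2, THEN conjunct2, THEN conjunct1] by (rule spec)
  have e4: "i \<noteq> j \<Longrightarrow> g 0 (e i) (e j) = 0" for i j
    using e'[THEN conjunct2, THEN conjunct2, THEN conjunct2] by (simp only: simp_thms)
  have "\<exists>c. e i = F c 0" for i
    by (rule F_surj[OF e1[of i]]) (rule exI)
  then have "\<forall>i. \<exists>c. e i = F c 0" by (rule allI)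
  from choice[OF this] obtain b where b: "\<And>i. e i = F (b i) 0" by auto
  have "ok (\<lambda>i. F (b i))"
    unfolding ok_def
  proof (intro conjI allI F_left_invariant)
    fix p
    show "pseudo_orthonormal_basis A g p (\<lambda>i. F (b i) p)"
      unfolding pseudo_orthonormal_basis_def
    proof (intro conjI allI ballI impI F_tangent)
      fix v assume "v \<in> tangent_space A p"
      then obtain c where c: "v = F c p" by (rule F_surj)
      obtain k where k: "F c 0 = (\<lambda>f. \<Sum>i\<in>UNIV. k i * e i f)" using e2[OF F_tangent] by (rule exE)
      have "c = (\<Sum>i\<in>UNIV. k i *\<^sub>R b i)"
        by (rule F_eqD[of _ 0]) (simp add: F_sum k b)
      then have "v = (\<lambda>f. \<Sum>i\<in>UNIV. k i * F (b i) p f)"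
        unfolding c by (intro ext) (simp only: F_sum)
      then show "\<exists>c. v = (\<lambda>f. \<Sum>i\<in>UNIV. c i * F (b i) p f)" by (intro exI[of _ k])
    next
      show "g p (F (b i) p) (F (b i) p) \<in> {1, - 1}" for i
        using e3[of i] by (simp only: b g_F)
      show "g p (F (b i) p) (F (b j) p) = 0" if "i \<noteq> j" for i j
        using e4[OF that] by (simp only: b g_F)
    qed
  qed
  then have "ok (SOME E. ok E)" by (rule someI[of ok])
  moreover have "some_frame A g = (SOME E. ok E)" by (simp only: some_frame_def ok_def)
  ultimately have ok: "ok (some_frame A g)" by (simp only:)
  have "\<exists>c. some_frame A g i = F c" for i
  proof -
    have "left_invariant A (some_frame A g i)" using ok[unfolded ok_def, THEN conjunct1] by (rule spec)
    then show ?thesis by (rule left_invariant_F) (rule exI)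
  qed
  then have "\<forall>i. \<exists>c. some_frame A g i = F c" by (rule allI)
  from choice[OF this] obtain b where b: "\<And>i. some_frame A g i = F (b i)" by auto
  have "pseudo_orthonormal_basis A g 0 (\<lambda>i. some_frame A g i 0)"
    using ok[unfolded ok_def, THEN conjunct2] by (rule spec)
  then have f': "pseudo_orthonormal_basis A g 0 (\<lambda>i. F (b i) 0)" by (simp only: b)
  note f = f'[unfolded pseudo_orthonormal_basis_def]
  show ?thesis
  proof (intro exI[of _ b] conjI allI impI)
    show "some_frame A g i = F (b i)" for i by (rule b)
    show "B (b i) (b j) = 0" if "i \<noteq> j" for i j
      using f[THEN conjunct2, THEN conjunct2, THEN conjunct2] that by (simp add: g_F)
    show "B (b i) (b i) \<in> {1, -1}" for i
      using f[THEN conjunct2, THEN conjunct2, THEN conjunct1] by (simp add: g_F)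
    fix x
    have "\<exists>c. F x 0 = (\<lambda>f. \<Sum>i\<in>UNIV. c i * F (b i) 0 f)"
      using f[THEN conjunct2, THEN conjunct1] F_tangent by (rule bspec)
    then obtain k where k: "F x 0 = (\<lambda>f. \<Sum>i\<in>UNIV. k i * F (b i) 0 f)" by (rule exE)
    have "x = (\<Sum>i\<in>UNIV. k i *\<^sub>R b i)"
      by (rule F_eqD[of _ 0]) (simp add: F_sum k)
    then show "\<exists>c. x = (\<Sum>i\<in>UNIV. c i *\<^sub>R b i)" by (intro exI[of _ k])
  qed
qed

lemma B_sum_left: "B (\<Sum>i\<in>I. k i *\<^sub>R a i) c = (\<Sum>i\<in>I. k i * B (a i) c)"
  by (induction I rule: infinite_finite_induct) (simp_all add: B_lin)

text \<open>Contraction in dimension 4, where \<open>\<tau>\<close> is the trace of \<open>p\<close> with respect to \<open>B\<close>.\<close>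

lemma ricci_schouten:
  assumes sym: "\<And>a b. p a b = p b a"
    and add: "\<And>a b c. p a (b + c) = p a b + p a c" and scale: "\<And>a b r. p a (r *\<^sub>R b) = r * p a b"
    and curv: "\<And>a b c d. B (curv a b c) d = B b c * p a d + p b c * B a d - B a c * p b d - p a c * B b d"
  shows "\<exists>\<tau>. \<forall>a c q. ricci A g nab (F a) (F c) q = \<tau> * B a c + 2 * p a c"
proof -
  obtain b where b': "(\<forall>i. some_frame A g i = F (b i)) \<and> (\<forall>i j. i \<noteq> j \<longrightarrow> B (b i) (b j) = 0) \<and>
     (\<forall>i. B (b i) (b i) \<in> {1, -1}) \<and> (\<forall>x. \<exists>c. x = (\<Sum>i\<in>UNIV. c i *\<^sub>R b i))"
    using orthonormal_frame by (rule exE)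
  have b: "some_frame A g i = F (b i)" "i \<noteq> j \<Longrightarrow> B (b i) (b j) = 0"
    "B (b i) (b i) = 1 \<or> B (b i) (b i) = -1" "\<exists>c. x = (\<Sum>i\<in>UNIV. c i *\<^sub>R b i)" for i j x
    using b' by auto
  define \<tau> where "\<tau> = (\<Sum>i\<in>UNIV. B (b i) (b i) * p (b i) (b i))"
  have sq: "B (b i) (b i) * B (b i) (b i) = 1" for i using b(3)[of i] by auto
  have zero: "p a 0 = 0" for a using scale[of a 0 0] by simp
  have p_sum: "p a (\<Sum>i\<in>I. k i *\<^sub>R x i) = (\<Sum>i\<in>I. k i * p a (x i))" if "finite I" for I and k :: "4 \<Rightarrow> real" and x a
    using that by (induction I rule: finite_induct) (simp_all add: add scale zero)
  have contract: "(\<Sum>i\<in>UNIV. B (b i) (b i) * (B (b i) c * p a (b i))) = p a c" for a c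
  proof -
    obtain k where k: "c = (\<Sum>i\<in>UNIV. k i *\<^sub>R b i)" using b(4) by (rule exE)
    have "B c (b i) = k i * B (b i) (b i)" for i
    proof -
      have "B c (b i) = (\<Sum>j\<in>UNIV. k j * B (b j) (b i))" unfolding k by (rule B_sum_left)
      also have "\<dots> = (\<Sum>j\<in>UNIV. if j = i then k j * B (b j) (b i) else 0)"
        by (rule sum.cong) (use b(2) in auto)
      finally show ?thesis by simp
    qed
    then have eq: "B (b i) (b i) * (B (b i) c * p a (b i)) = k i * p a (b i)" for i
      using sq[of i] B_sym[of "b i" c] by simp
    have "(\<Sum>i\<in>UNIV. k i * p a (b i)) = p a c"
      unfolding k by (simp add: p_sum)
    then show ?thesis by (simp only: eq)
  qed
  have contract': "(\<Sum>i\<in>UNIV. B (b i) (b i) * (p (b i) c * B a (b i))) = p a c" for a c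
  proof -
    have "B (b i) (b i) * (p (b i) c * B a (b i)) = B (b i) (b i) * (B (b i) a * p c (b i))" for i
      using sym[of "b i" c] B_sym[of "b i" a] by simp
    then show ?thesis using contract[of a c] sym[of a c] by (simp only: contract)
  qed
  have "ricci A g nab (F a) (F c) q = \<tau> * B a c + 2 * p a c" for a c q
  proof -
    have "ricci A g nab (F a) (F c) q = (\<Sum>i\<in>UNIV. B (b i) (b i) * B (curv (b i) a c) (b i))"
      by (simp add: ricci_def b(1) curvature_F g_F)
    also have "\<dots> = (\<Sum>i\<in>UNIV. B a c * (B (b i) (b i) * p (b i) (b i)) + p a c * (B (b i) (b i) * B (b i) (b i))
         - B (b i) (b i) * (B (b i) c * p a (b i)) - B (b i) (b i) * (p (b i) c * B a (b i)))"
      by (rule sum.cong) (simp_all add: curv algebra_simps)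
    also have "\<dots> = B a c * \<tau> + p a c * 4 - p a c - p a c"
      unfolding sum_subtractf sum.distrib contract contract' \<tau>_def sum_distrib_left[symmetric] sq by simp
    finally show ?thesis by simp
  qed
  then show ?thesis by (intro exI[of _ \<tau>] allI)
qed

lemma B_riesz:
  assumes "linear f"
  shows "\<exists>H. \<forall>x. B H x = f x"
proof -
  define L :: "real ^ 4 \<Rightarrow> real ^ 4" where "L H = (\<chi> i. B H (axis i 1))" for H
  have ex: "h x = (\<Sum>i\<in>UNIV. x $ i * h (axis i 1))" if "linear h" for h :: "real ^ 4 \<Rightarrow> real" and x
  proof -
    have "h (\<Sum>i\<in>UNIV. x $ i *\<^sub>R axis i 1) = (\<Sum>i\<in>UNIV. x $ i * h (axis i 1))"
      using that by (simp add: linear_sum linear_scale)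
    then show ?thesis using basis_expansion[of x] by (simp add: scalar_mult_eq_scaleR)
  qed
  have lB: "linear (B H)" for H by (rule linearI) (simp_all add: B_lin)
  have lin: "linear L" by (rule linearI) (simp_all add: L_def vec_eq_iff B_lin)
  have "inj L"
    unfolding linear_injective_0[OF lin]
  proof (intro allI impI)
    fix H assume "L H = 0"
    then have "B H (axis i 1) = 0" for i by (simp add: L_def vec_eq_iff)
    then have "B H x = 0" for x using ex[OF lB, of H x] by simp
    then show "H = 0" by (rule B_nondeg)
  qed
  then have "surj L" using lin linear_injective_imp_surjective by blast
  then obtain H where "L H = (\<chi> i. f (axis i 1))" by (metis surjD)
  then have "B H (axis i 1) = f (axis i 1)" for i by (simp add: L_def vec_eq_iff)
  then have "B H x = f x" for x using ex[OF lB, of H x] ex[OF assms, of x] by simp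
  then show ?thesis by (intro exI[of _ H] allI)
qed

lemma bracket_apply:
  assumes "smooth_near A q f"
  shows "F a q (\<lambda>r. F b r f) - F b q (\<lambda>r. F a r f) = F (N a b - N b a) q f"
  using assms unfolding lie_bracket_F[symmetric] by (simp add: lie_bracket_def)

lemmas F_deriv_add = tangent_add[OF F_tangent]
lemmas F_deriv_mult = tangent_mult[OF F_tangent]

text \<open>Here \<open>X k c\<close> and \<open>T k b c\<close> are the first and second derivatives of the flat coordinate \<open>x\<^sub>k\<close> along
  left-invariant fields. On the domain of the coordinates, \<open>\<psi> B a b = \<Sum>\<^sub>k \<epsilon>\<^sub>k X k a X k b\<close>. Its first
  derivative and the symmetry of second derivatives feed \<open>conformal_koszul\<close>, which determines
  \<open>W b c d = \<Sum>\<^sub>k \<epsilon>\<^sub>k T k b c X k d\<close>. Differentiating this once more at the neutral element, and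
  comparing third derivatives in both orders, gives the hypothesis of \<open>conformal_curvature\<close>. As the
  curvature has constant coordinates, a single point suffices.\<close>

lemma flat_schouten:
  assumes "conformally_flat A g"
  shows "\<exists>p. (\<forall>a b. p a b = p b a) \<and> (\<forall>a b c. p a (b + c) = p a b + p a c) \<and>
    (\<forall>a b r. p a (r *\<^sub>R b) = r * p a b) \<and>
    (\<forall>a b c d. B (curv a b c) d = B b c * p a d + p b c * B a d - B a c * p b d - p a c * B b d)"
proof -
  obtain U x \<sigma> and \<epsilon> :: "4 \<Rightarrow> real" where h: "0 \<in> U \<and> smooth_atlas (insert (U, x) A) \<and> smooth_fun_on A U \<sigma> \<and>
        (\<forall>i::4. \<epsilon> i \<in> {1, -1}) \<and>
        (\<forall>q\<in>U. \<forall>u\<in>tangent_space A q. \<forall>v\<in>tangent_space A q.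
           g q u v = exp (2 * \<sigma> q) *
             (\<Sum>i\<in>UNIV. \<epsilon> i * u (\<lambda>r. x r $ i) * v (\<lambda>r. x r $ i)))"
    using assms[unfolded conformally_flat_def, THEN spec[of _ 0]] by (elim exE)
  note U0 = h[THEN conjunct1] and at = h[THEN conjunct2, THEN conjunct1]
    and \<sigma> = h[THEN conjunct2, THEN conjunct2, THEN conjunct1]
  have \<epsilon>: "\<epsilon> i = 1 \<or> \<epsilon> i = -1" for i
    using h[THEN conjunct2, THEN conjunct2, THEN conjunct2, THEN conjunct1] by simp
  have gU: "g q u v = exp (2 * \<sigma> q) * (\<Sum>i\<in>UNIV. \<epsilon> i * u (\<lambda>r. x r $ i) * v (\<lambda>r. x r $ i))"
    if "q \<in> U" "u \<in> tangent_space A q" "v \<in> tangent_space A q" for q u v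
    by (rule h[THEN conjunct2, THEN conjunct2, THEN conjunct2, THEN conjunct2,
          THEN bspec, THEN bspec, THEN bspec, OF that])
  have "open U" using at by (simp add: smooth_atlas_def is_chart_def)
  define X where "X k c r = F c r (\<lambda>r. x r $ k)" for k c r
  define T where "T k b c r = F b r (X k c)" for k b c r
  define S where "S b r = F b r \<sigma>" for b r
  define \<psi> where "\<psi> r = exp (- 2 * \<sigma> r)" for r
  have x_smooth: "smooth_fun_on A U (\<lambda>r. x r $ k)" for k
  proof (rule smooth_fun_onI[OF _ \<open>open U\<close>])
    fix V y n assume V: "(V, y) \<in> A" and op: "open (y ` (V \<inter> U))"
    have "smooth_transition (V, y) (U, x)" using at V by (simp add: smooth_atlas_def)
    then have "Ck_on n (y ` (V \<inter> U)) (\<lambda>s. x (inv_into V y s))"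
      by (simp only: smooth_transition_def smooth_on_def o_def prod.case)
    then show "Ck_on n (y ` (V \<inter> U)) (\<lambda>s. x (inv_into V y s) $ k)"
      by (rule Ck_on_linear[OF bounded_linear_vec_nth op])
  qed
  have F_smooth: "smooth_fun_on A U (\<lambda>r. F c r f)" if "smooth_fun_on A U f" for c f
    using F_vector_field[of c] that \<open>open U\<close> unfolding vector_field_def by blast
  have X_smooth: "smooth_fun_on A U (X k c)" for k c
    using F_smooth[OF x_smooth] unfolding X_def[abs_def] .
  have T_smooth: "smooth_fun_on A U (T k b c)" for k b c
    using F_smooth[OF X_smooth] unfolding T_def[abs_def] .
  have S_smooth: "smooth_fun_on A U (S b)" for b
    using F_smooth[OF \<sigma>] unfolding S_def[abs_def] .
  have near: "smooth_near A r f" if "smooth_fun_on A U f" "r \<in> U" for r f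
    by (rule smooth_nearI[OF \<open>open U\<close> that(2,1)])
  note sm = near[OF X_smooth] near[OF T_smooth] near[OF S_smooth] near[OF \<sigma>] smooth_near_const
    smooth_near_add smooth_near_mult
  have \<psi>_near: "smooth_near A r \<psi>" if "r \<in> U" for r
    unfolding \<psi>_def[abs_def] using smooth_fun_on_exp[OF \<open>open U\<close> smooth_fun_on_cmult[OF \<open>open U\<close> \<sigma>]]
    by (rule near) (rule that)
  have \<psi>_deriv: "F a r \<psi> = - 2 * S a r * \<psi> r" if "r \<in> U" for a r
  proof -
    have "F a r \<psi> = \<psi> r * F a r (\<lambda>r. - 2 * \<sigma> r)"
      unfolding \<psi>_def[abs_def] using that by (intro tangent_exp[OF F_tangent] sm)
    then show ?thesis
      unfolding tangent_cmult[OF F_tangent near[OF \<sigma> that]] S_def by simp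
  qed
  have X_add: "X k (a + b) r = X k a r + X k b r" and X_scale: "X k (t *\<^sub>R a) r = t * X k a r" for k a b r t
    by (simp_all add: X_def F_add F_scale)
  have rel: "\<psi> r * B a b = (\<Sum>k\<in>UNIV. \<epsilon> k * (X k a r * X k b r))" if "r \<in> U" for r a b
  proof -
    have "B a b = exp (2 * \<sigma> r) * (\<Sum>k\<in>UNIV. \<epsilon> k * (X k a r * X k b r))"
      using gU[OF that F_tangent F_tangent, of a b] by (simp add: g_F X_def mult.assoc)
    then show ?thesis by (simp add: \<psi>_def mult.assoc[symmetric] flip: exp_add)
  qed
  have deriv_sum: "F a r (\<lambda>q. \<Sum>k\<in>UNIV. \<epsilon> k * (f k q * h k q)) =
      (\<Sum>k\<in>UNIV. \<epsilon> k * (f k r * F a r (h k) + F a r (f k) * h k r))"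
    if "\<And>k. smooth_near A r (f k)" "\<And>k. smooth_near A r (h k)" for a r and f h :: "4 \<Rightarrow> 'g \<Rightarrow> real"
  proof -
    have "F a r (\<lambda>q. \<epsilon> k * (f k q * h k q)) = \<epsilon> k * (f k r * F a r (h k) + F a r (f k) * h k r)" for k
      using that[of k] by (simp only: tangent_cmult[OF F_tangent] F_deriv_mult smooth_near_mult)
    moreover have "F a r (\<lambda>q. \<Sum>k\<in>UNIV. \<epsilon> k * (f k q * h k q)) = (\<Sum>k\<in>UNIV. F a r (\<lambda>q. \<epsilon> k * (f k q * h k q)))"
      by (rule tangent_sum[OF F_tangent, THEN conjunct2])
        (simp_all only: finite smooth_near_mult smooth_near_const that)
    ultimately show ?thesis by simp
  qed
  have T_torsion: "T k b c r - T k c b r = X k (N b c - N c b) r" if "r \<in> U" for k b c r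
    using bracket_apply[OF near[OF x_smooth that]] by (simp add: T_def X_def[abs_def])
  define W where "W r b c d = (\<Sum>k\<in>UNIV. \<epsilon> k * (T k b c r * X k d r))" for r b c d
  define M where "M r b c d = B (N b c) d - S b r * B c d - S c r * B b d + S d r * B b c" for r b c d
  have W: "W r b c d = \<psi> r * M r b c d" if r: "r \<in> U" for r b c d
    unfolding M_def
  proof (rule conformal_koszul)
    fix b c d
    have "W r b c d - W r c b d = (\<Sum>k\<in>UNIV. \<epsilon> k * (X k (N b c - N c b) r * X k d r))"
      unfolding W_def sum_subtractf[symmetric] T_torsion[OF r, symmetric] by (simp add: algebra_simps)
    then show "W r b c d - W r c b d = \<psi> r * B (N b c - N c b) d"
      by (simp add: rel[OF r])
    have "F b r (\<lambda>q. \<Sum>k\<in>UNIV. \<epsilon> k * (X k c q * X k d q)) = F b r (\<lambda>q. B c d * \<psi> q)"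
    proof (rule tangent_local[OF F_tangent \<open>open U\<close> r])
      show "smooth_near A r (\<lambda>q. \<Sum>k\<in>UNIV. \<epsilon> k * (X k c q * X k d q))"
        by (rule tangent_sum[OF F_tangent, THEN conjunct1]) (simp_all add: sm r)
    qed (simp add: rel[symmetric] mult.commute)
    then have "(\<Sum>k\<in>UNIV. \<epsilon> k * (X k c r * T k b d r + T k b c r * X k d r)) = B c d * F b r \<psi>"
      using tangent_cmult[OF F_tangent \<psi>_near[OF r]] by (simp add: deriv_sum sm r T_def)
    then have "W r b c d + W r b d c = B c d * F b r \<psi>"
      unfolding W_def sum.distrib[symmetric] by (simp add: algebra_simps)
    then show "W r b c d + W r b d c = - 2 * S b r * (\<psi> r * B c d)"
      by (simp add: \<psi>_deriv r)
  qed
  define s where "s b = S b 0" for b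
  define s2 where "s2 a b = F a 0 (S b)" for a b
  define T3 where "T3 k a b c = F a 0 (T k b c)" for k a b c
  define M' where "M' a b c d = - s2 a b * B c d - s2 a c * B b d + s2 a d * B b c" for a b c d
  have s_lin: "linear s" by (rule linearI) (simp_all add: s_def S_def F_add F_scale)
  obtain H where "\<forall>x. B H x = s x" using B_riesz[OF s_lin] by (rule exE)
  then have H: "B H x = s x" for x by (rule spec)
  have s_alg: "s (a + b) = s a + s b" "s (a - b) = s a - s b" "s (t *\<^sub>R a) = t * s a" for a b t
    using s_lin by (simp_all add: linear_add linear_diff linear_scale)
  have comm: "s2 a b - s2 b a = s (N a b - N b a)" for a b
    using bracket_apply[OF near[OF \<sigma> U0]] by (simp add: s2_def s_def S_def[abs_def])
  have \<psi>0: "\<psi> 0 \<noteq> 0" by (simp add: \<psi>_def)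
  define G where "G b c = N b c - s b *\<^sub>R c - s c *\<^sub>R b + B b c *\<^sub>R H" for b c
  have M_G: "M 0 b c d = B (G b c) d" for b c d
    by (simp add: M_def G_def B_lin H s_def)
  define L :: "real ^ 4 \<Rightarrow> real ^ 4" where "L d = (\<chi> k. X k d 0)" for d
  have L_lin: "linear L" by (rule linearI) (simp_all add: L_def vec_eq_iff X_add X_scale)
  have "inj L"
    unfolding linear_injective_0[OF L_lin]
  proof (intro allI impI)
    fix d assume "L d = 0"
    then have "X k d 0 = 0" for k by (simp add: L_def vec_eq_iff)
    then have "\<psi> 0 * B d c = 0" for c by (simp add: rel[OF U0])
    then show "d = 0" using \<psi>0 by (intro B_nondeg) simp
  qed
  then have L_surj: "surj L" using L_lin linear_injective_imp_surjective by blast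
  \<comment> \<open>\<open>W\<close> knows \<open>T k b c\<close> only paired with the \<open>X k d\<close>. These fill the whole space, so \<open>T k b c\<close> itself is known.\<close>
  have T_G: "T k b c 0 = X k (G b c) 0" for k b c
  proof -
    define w where "w k = \<epsilon> k * (T k b c 0 - X k (G b c) 0)" for k
    obtain d where "L d = (\<chi> k. w k)" using L_surj by (metis surjD)
    then have d: "X k d 0 = w k" for k by (simp add: L_def vec_eq_iff)
    have "(\<Sum>k\<in>UNIV. w k * X k d 0) = W 0 b c d - \<psi> 0 * B (G b c) d"
      unfolding rel[OF U0] W_def w_def sum_subtractf[symmetric] by (simp add: algebra_simps)
    then have "(\<Sum>k\<in>UNIV. w k * w k) = 0" by (simp add: d W[OF U0] M_G)
    then have "w k * w k = 0" by (subst (asm) sum_nonneg_eq_0_iff) auto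
    then show ?thesis using \<epsilon>[of k] by (auto simp: w_def)
  qed
  have TT: "(\<Sum>k\<in>UNIV. \<epsilon> k * (T k b c 0 * T k a d 0)) = \<psi> 0 * M 0 a d (G b c)" for a b c d
  proof -
    have "(\<Sum>k\<in>UNIV. \<epsilon> k * (T k b c 0 * T k a d 0)) = W 0 a d (G b c)"
      unfolding W_def T_G[of _ b c] by (simp add: mult.commute)
    then show ?thesis by (simp add: W[OF U0])
  qed
  have deriv: "\<psi> 0 * M 0 a d (G b c) + (\<Sum>k\<in>UNIV. \<epsilon> k * (T3 k a b c * X k d 0))
      = \<psi> 0 * (M' a b c d - 2 * s a * M 0 b c d)" for a b c d
  proof -
    have "F a 0 (\<lambda>q. \<Sum>k\<in>UNIV. \<epsilon> k * (T k b c q * X k d q)) =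
        F a 0 (\<lambda>q. \<psi> q * (B (N b c) d + (- B c d * S b q + (- B b d * S c q + B b c * S d q))))"
    proof (rule tangent_local[OF F_tangent \<open>open U\<close> U0])
      show "smooth_near A 0 (\<lambda>q. \<Sum>k\<in>UNIV. \<epsilon> k * (T k b c q * X k d q))"
        by (rule tangent_sum[OF F_tangent, THEN conjunct1]) (simp_all add: sm U0)
      fix q assume "q \<in> U"
      from W[OF this, of b c d]
      show "(\<Sum>k\<in>UNIV. \<epsilon> k * (T k b c q * X k d q)) =
         \<psi> q * (B (N b c) d + (- B c d * S b q + (- B b d * S c q + B b c * S d q)))"
        unfolding W_def M_def by (simp add: algebra_simps)
    qed
    also have "\<dots> = \<psi> 0 * M' a b c d - 2 * s a * \<psi> 0 * M 0 b c d"
    proof -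
      note near0 = near[OF S_smooth U0]
      have "F a 0 (\<lambda>q. B (N b c) d + (- B c d * S b q + (- B b d * S c q + B b c * S d q))) = M' a b c d"
        by (simp only: F_deriv_add F_deriv_mult sm(5-7) near0 F_const) (simp add: M'_def s2_def)
      moreover have "smooth_near A 0 (\<lambda>q. B (N b c) d + (- B c d * S b q + (- B b d * S c q + B b c * S d q)))"
        by (intro sm(5-7) near0)
      ultimately show ?thesis
        by (simp only: F_deriv_mult[OF \<psi>_near[OF U0]] \<psi>_deriv[OF U0]) (simp add: M_def s_def algebra_simps)
    qed
    finally show ?thesis
      using TT[of b c a d]
      by (simp add: deriv_sum sm U0 T_def[symmetric] T3_def[symmetric] distrib_left sum.distrib algebra_simps)
  qed
  have T3_comm: "T3 k a b c - T3 k b a c = T k (N a b - N b a) c 0" for k a b c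
    using bracket_apply[OF near[OF X_smooth U0], of a b] by (simp add: T3_def T_def[abs_def])
  have int: "M 0 (N a b - N b a) c d = - 2 * s a * M 0 b c d + 2 * s b * M 0 a c d
      + M' a b c d - M' b a c d - M 0 a d (G b c) + M 0 b d (G a c)" for a b c d
  proof -
    have "\<psi> 0 * M 0 (N a b - N b a) c d = W 0 (N a b - N b a) c d" by (simp add: W[OF U0])
    also have "\<dots> = (\<Sum>k\<in>UNIV. \<epsilon> k * (T3 k a b c * X k d 0)) - (\<Sum>k\<in>UNIV. \<epsilon> k * (T3 k b a c * X k d 0))"
      unfolding W_def T3_comm[symmetric] sum_subtractf[symmetric] by (simp add: algebra_simps)
    also have "\<dots> = \<psi> 0 * (- 2 * s a * M 0 b c d + 2 * s b * M 0 a c d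
      + M' a b c d - M' b a c d - M 0 a d (G b c) + M 0 b d (G a c))"
      using deriv[of a d b c] deriv[of b d a c] by (simp add: algebra_simps)
    finally show ?thesis using \<psi>0 by simp
  qed
  define p where "p a b = - s2 a b + s (N a b) - s a * s b + s H / 2 * B a b" for a b
  show ?thesis
  proof (intro exI[of _ p] conjI allI)
    show "p a b = p b a" for a b
      using comm[of a b] B_sym[of a b] by (simp add: p_def s_alg algebra_simps)
    have s2_add: "s2 a (b + c) = s2 a b + s2 a c" and s2_scale: "s2 a (t *\<^sub>R b) = t * s2 a b" for a b c t
    proof -
      have "S (b + c) = (\<lambda>q. S b q + S c q)" "S (t *\<^sub>R b) = (\<lambda>q. t * S b q)"
        by (simp_all add: S_def[abs_def] F_add F_scale)
      then show "s2 a (b + c) = s2 a b + s2 a c" "s2 a (t *\<^sub>R b) = t * s2 a b"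
        by (simp_all add: s2_def F_deriv_add tangent_cmult[OF F_tangent] near[OF S_smooth U0])
    qed
    show "p a (b + c) = p a b + p a c" "p a (t *\<^sub>R b) = t * p a b" for a b c t
      by (simp_all add: p_def s2_add s2_scale N_lin B_lin s_alg algebra_simps)
    show "B (curv a b c) d = B b c * p a d + p b c * B a d - B a c * p b d - p a c * B b d" for a b c d
      unfolding p_def using int[of a b c d] unfolding M_def M'_def G_def s_def[symmetric]
      by (rule conformal_curvature[where H = H and s = s and ?s2.0 = s2, OF H comm])
  qed
qed

text \<open>The Ricci operator preserves left-invariant fields. The form \<open>R\<close> is the Ricci tensor with \<open>F a\<close> in
  one slot, constant on the group.\<close>

lemma ricci_operator_F:
  assumes Q: "ricci_operator A g nab Q"
    and ric: "\<And>c q. ricci A g nab (F a) (F c) q = R c"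
  shows "\<exists>b. Q (F a) = F b \<and> (\<forall>c. B b c = R c)"
proof -
  have Q': "vector_field A (Q (F a))" "g p (Q (F a) p) (F c p) = R c" for p c
    using Q F_vector_field unfolding ricci_operator_def ric[symmetric, of _ p] by blast+
  have ex: "\<exists>b. Q (F a) p = F b p \<and> (\<forall>c. B b c = R c)" for p
  proof -
    have "Q (F a) p \<in> tangent_space A p" using Q'(1) unfolding vector_field_def by blast
    then obtain b where b: "Q (F a) p = F b p" by (rule F_surj)
    then have "B b c = R c" for c using Q'(2)[of p c] by (simp add: g_F)
    then show ?thesis using b by blast
  qed
  obtain b where b: "Q (F a) 0 = F b 0 \<and> (\<forall>c. B b c = R c)" using ex by (rule exE)
  have "Q (F a) p = F b p" for p
  proof -
    obtain b' where b': "Q (F a) p = F b' p \<and> (\<forall>c. B b' c = R c)" using ex by (rule exE)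
    then have "b' = b" using b by (intro eqI_B) simp
    then show ?thesis using b' by simp
  qed
  then have "Q (F a) = F b" by (rule ext)
  then show ?thesis using b by blast
qed

lemma schouten_operator:
  assumes "conformally_flat A g" and Q: "ricci_operator A g nab Q"
  shows "\<exists>P \<tau>. conformally_flat_algebra4 B N P \<and> (\<forall>a. Q (F a) = F (\<tau> *\<^sub>R a + 2 *\<^sub>R P a))"
proof -
  obtain p where "(\<forall>a b. p a b = p b a) \<and> (\<forall>a b c. p a (b + c) = p a b + p a c) \<and>
    (\<forall>a b r. p a (r *\<^sub>R b) = r * p a b) \<and>
    (\<forall>a b c d. B (curv a b c) d = B b c * p a d + p b c * B a d - B a c * p b d - p a c * B b d)"
    using flat_schouten[OF assms(1)] by (rule exE)
  then have p: "p a b = p b a" "p a (b + c) = p a b + p a c" "p a (r *\<^sub>R b) = r * p a b"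
    "B (curv a b c) d = B b c * p a d + p b c * B a d - B a c * p b d - p a c * B b d" for a b c d r
    by blast+
  obtain \<tau> where "\<forall>a c q. ricci A g nab (F a) (F c) q = \<tau> * B a c + 2 * p a c"
    using ricci_schouten[OF p] by (rule exE)
  then have ric: "ricci A g nab (F a) (F c) q = \<tau> * B a c + 2 * p a c" for a c q by blast
  have "\<exists>b. Q (F a) = F b \<and> (\<forall>c. B b c = \<tau> * B a c + 2 * p a c)" for a
    by (rule ricci_operator_F[OF Q ric])
  then have "\<forall>a. \<exists>b. Q (F a) = F b \<and> (\<forall>c. B b c = \<tau> * B a c + 2 * p a c)" by (rule allI)
  from choice[OF this] obtain q where q: "\<forall>a. Q (F a) = F (q a) \<and> (\<forall>c. B (q a) c = \<tau> * B a c + 2 * p a c)"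
    by (rule exE)
  define P where "P a = (1/2) *\<^sub>R (q a - \<tau> *\<^sub>R a)" for a
  have BP: "B (P a) c = p a c" for a c
    using q by (simp add: P_def B_lin)
  have "conformally_flat_algebra4 B N P"
  proof
    show "B (P a) b = B a (P b)" for a b
      using BP[of a b] BP[of b a] p(1)[of a b] B_sym[of a "P b"] by simp
    show "curv a b c = B b c *\<^sub>R P a + B (P b) c *\<^sub>R a - B a c *\<^sub>R P b - B (P a) c *\<^sub>R b" for a b c
      by (rule eqI_B) (simp add: p(4) B_lin BP)
  qed simp
  moreover have "Q (F a) = F (\<tau> *\<^sub>R a + 2 *\<^sub>R P a)" for a
    using q by (simp add: P_def)
  ultimately show ?thesis by blast
qed

lemma F_axis: "F (axis 1 1) = V 0" "F (axis 2 1) = V 1" "F (axis 3 1) = V 2" "F (axis 4 1) = V 3"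
  by (intro ext, simp add: F_4 axis_def)+

lemma axis_expand:
  "x = x $ 1 *\<^sub>R axis 1 1 + x $ 2 *\<^sub>R axis 2 1 + x $ 3 *\<^sub>R axis 3 1 + x $ 4 *\<^sub>R axis 4 (1::real)" for x :: "real ^ 4"
  by (simp add: vec_eq_iff forall_4 axis_def)

lemma F_lin: "(\<lambda>p f. r * F a p f + F b p f) = F (r *\<^sub>R a + b)"
  by (intro ext) (simp add: F_add F_scale)

section \<open>Walker structures on the group\<close>

lemma walker_structure_algebra:
  assumes alg: "conformally_flat_algebra4 B N P" and D: "walker_structure A g nab D"
  shows "\<exists>D0. conformally_flat_algebra4.walker B N D0"
proof -
  obtain r W where r: "r \<in> {1, 2 :: nat}" and W: "left_invariant_frame A r W"
    and Dp: "D = (\<lambda>p. {v. \<exists>c. v = (\<lambda>f. \<Sum>i<r. c i * W i p f)})"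
    using D[unfolded walker_structure_def, THEN conjunct1] by (elim bexE exE conjE)
  have null: "g p u v = 0" if "u \<in> D p" "v \<in> D p" for p u v
    using D[unfolded walker_structure_def, THEN conjunct2, THEN conjunct1, THEN spec, THEN bspec, THEN bspec, OF that] .
  have par: "nab X Y p \<in> D p" if "vector_field A X" "vector_field A Y" "\<And>p. Y p \<in> D p" for X Y p
    using D[unfolded walker_structure_def, THEN conjunct2, THEN conjunct2] that by blast
  have "\<exists>c. W i = F c" if "i < r" for i
  proof -
    have "left_invariant A (W i)" using W that unfolding left_invariant_frame_def by blast
    then show ?thesis by (rule left_invariant_F) (rule exI)
  qed
  then have "\<forall>i. \<exists>c. i < r \<longrightarrow> W i = F c" by blast
  from choice[OF this] obtain w where w: "\<forall>i. i < r \<longrightarrow> W i = F (w i)" by (rule exE)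
  have comb: "(\<lambda>f. \<Sum>i<r. c i * W i p f) = F (\<Sum>i<r. c i *\<^sub>R w i) p" for c p
    by (rule ext) (simp add: F_sum w)
  have DF: "F x p \<in> D p \<longleftrightarrow> (\<exists>c. x = (\<Sum>i<r. c i *\<^sub>R w i))" for x p
  proof
    assume "F x p \<in> D p"
    then obtain c where "F x p = F (\<Sum>i<r. c i *\<^sub>R w i) p" unfolding Dp comb by blast
    then have "x = (\<Sum>i<r. c i *\<^sub>R w i)" by (intro F_eqD[of _ p]) simp
    then show "\<exists>c. x = (\<Sum>i<r. c i *\<^sub>R w i)" by blast
  next
    assume "\<exists>c. x = (\<Sum>i<r. c i *\<^sub>R w i)"
    then show "F x p \<in> D p" unfolding Dp comb by blast
  qed
  define D0 where "D0 = {x. \<exists>c. x = (\<Sum>i<r. c i *\<^sub>R w i)}"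
  have sub: "subspace D0"
  proof (rule subspaceI)
    show "0 \<in> D0" unfolding D0_def by (auto intro!: exI[of _ "\<lambda>_. 0"])
    fix x y assume "x \<in> D0" "y \<in> D0"
    then obtain c d where "x = (\<Sum>i<r. c i *\<^sub>R w i)" "y = (\<Sum>i<r. d i *\<^sub>R w i)" by (auto simp: D0_def)
    then have "x + y = (\<Sum>i<r. (c i + d i) *\<^sub>R w i)" by (simp add: sum.distrib scaleR_add_left)
    then show "x + y \<in> D0" unfolding D0_def by (intro CollectI exI[of _ "\<lambda>i. c i + d i"])
  next
    fix t x assume "x \<in> D0"
    then obtain c where "x = (\<Sum>i<r. c i *\<^sub>R w i)" by (auto simp: D0_def)
    then have "t *\<^sub>R x = (\<Sum>i<r. (t * c i) *\<^sub>R w i)" by (simp add: scaleR_sum_right)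
    then show "t *\<^sub>R x \<in> D0" unfolding D0_def by (intro CollectI exI[of _ "\<lambda>i. t * c i"])
  qed
  have "D0 \<subseteq> span (w ` {..<r})"
    unfolding D0_def by (auto intro!: span_sum span_scale intro: span_base)
  then have "dim D0 \<le> card (w ` {..<r})" by (rule dim_le_card) simp
  also have "\<dots> \<le> r" using card_image_le[of "{..<r}" w] by simp
  finally have dim: "dim D0 \<le> 2" using r by auto
  have "w 0 \<in> D0"
  proof -
    have "w 0 = (\<Sum>i<r. (if i = 0 then 1 else 0) *\<^sub>R w i)"
      using r by (auto simp: numeral_2_eq_2 lessThan_Suc)
    then show ?thesis unfolding D0_def by (intro CollectI exI[of _ "\<lambda>i. if i = 0 then 1 else 0"])
  qed
  moreover have "w 0 \<noteq> 0"
  proof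
    assume "w 0 = 0"
    then have "(\<Sum>i<r. (if i = 0 then 1 else 0) *\<^sub>R w i) = 0"
      using r by (auto simp: numeral_2_eq_2 lessThan_Suc)
    then have dep: "\<forall>f. (\<Sum>i<r. (if i = 0 then 1 else 0) * W i 0 f) = 0"
      using fun_cong[OF comb[of "\<lambda>i. if i = 0 then 1 else 0" 0]] by (simp add: F_zero)
    have ind: "\<forall>p c. (\<forall>f. (\<Sum>i<r. c i * W i p f) = 0) \<longrightarrow> (\<forall>i<r. c i = 0)"
      using W unfolding left_invariant_frame_def by (rule conjunct2)
    have "\<forall>i<r. (if i = 0 then 1 else 0) = (0::real)"
      by (rule ind[THEN spec[of _ 0], THEN spec[of _ "\<lambda>i. if i = 0 then 1 else 0"], THEN mp, OF dep])
    from this[THEN spec[of _ 0]] show False using r by auto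
  qed
  ultimately have nz: "D0 \<noteq> {0}" by blast
  have mem: "x \<in> D0 \<longleftrightarrow> F x p \<in> D p" for x p by (simp add: DF D0_def)
  have "conformally_flat_algebra4.walker B N D0"
    unfolding conformally_flat_algebra4.walker_def[OF alg]
  proof (intro conjI sub nz dim ballI allI)
    show "B x y = 0" if "x \<in> D0" "y \<in> D0" for x y
      using null[of "F x 0" 0 "F y 0"] that mem by (simp add: B_def)
    show "N a x \<in> D0" if "x \<in> D0" for a x
    proof -
      have "nab (F a) (F x) 0 \<in> D 0"
        by (intro par F_vector_field) (use that mem in blast)
      then show ?thesis by (simp add: nab_F mem[of _ 0])
    qed
  qed
  then show ?thesis by blast
qed

text \<open>As \<open>Q = \<tau> + 2 P\<close>, a Jordan block of \<open>Q\<close> is one of \<open>P\<close> up to the factor \<open>1 / 2\<close> in the off-diagonal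
  entries, which has to be scaled away below.\<close>

lemma jordan_block_schouten:
  assumes P: "\<And>a. Q (F a) = F (\<tau> *\<^sub>R a + 2 *\<^sub>R P a)"
    and J: "jordan_block Q l n W" and W: "\<And>j. j < n \<Longrightarrow> W j = F (v j)" and j: "j < n"
  shows "P (v j) = ((l - \<tau>) / 2) *\<^sub>R v j + (1 / 2) *\<^sub>R (if j = 0 then 0 else v (j - 1))"
proof -
  let ?b = "if j = 0 then 0 else v (j - 1)"
  have "Q (W j) = (\<lambda>p f. l * W j p f + (if j = 0 then 0 else W (j - 1) p f))"
    using J j unfolding jordan_block_def by blast
  also have "\<dots> = (\<lambda>p f. l * F (v j) p f + F ?b p f)"
    using W[of j] W[of "j - 1"] j by (cases "j = 0") (simp_all add: F_zero)
  finally have "F (\<tau> *\<^sub>R v j + 2 *\<^sub>R P (v j)) = F (l *\<^sub>R v j + ?b)"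
    unfolding W[OF j] P F_lin .
  then have "\<tau> *\<^sub>R v j + 2 *\<^sub>R P (v j) = l *\<^sub>R v j + ?b" by (simp only: F_injective)
  then have "2 *\<^sub>R P (v j) = (l - \<tau>) *\<^sub>R v j + ?b" by (simp add: algebra_simps)
  then have "(1/2) *\<^sub>R (2 *\<^sub>R P (v j)) = (1/2) *\<^sub>R ((l - \<tau>) *\<^sub>R v j + ?b)" by (rule arg_cong)
  then show ?thesis by (simp add: scaleR_add_right)
qed

lemma no_walker_1_12:
  assumes cf: "conformally_flat A g" and Q: "ricci_operator A g nab Q"
    and l: "l1 \<noteq> l2" and J: "jordan_block Q l1 1 V" "jordan_block Q l2 1 (\<lambda>j. V (1 + j))"
      "jordan_block Q l2 2 (\<lambda>j. V (2 + j))"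
    and pos: "g 0 (V 0 0) (V 0 0) > 0"
  shows "\<not> walker_structure A g nab D"
proof
  assume D: "walker_structure A g nab D"
  obtain P \<tau> where sch: "conformally_flat_algebra4 B N P" "\<forall>a. Q (F a) = F (\<tau> *\<^sub>R a + 2 *\<^sub>R P a)"
    using schouten_operator[OF cf Q] by blast
  note jb = jordan_block_schouten[where P = P and \<tau> = \<tau>, OF sch(2)[rule_format]]
  let ?e1 = "axis 1 1 :: real ^ 4" and ?e2 = "axis 2 1 :: real ^ 4"
    and ?e3 = "axis 3 1 :: real ^ 4" and ?e4 = "axis 4 1 :: real ^ 4"
  have P1: "P ?e1 = ((l1 - \<tau>) / 2) *\<^sub>R ?e1"
    using jb[OF J(1), of "\<lambda>j. ?e1" 0] by (simp add: F_axis)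
  have P2: "P ?e2 = ((l2 - \<tau>) / 2) *\<^sub>R ?e2"
    using jb[OF J(2), of "\<lambda>j. ?e2" 0] by (simp add: F_axis)
  have v: "V (2 + j) = F (if j = 0 then ?e3 else ?e4)" if "j < 2" for j
    using that by (cases "j = 0") (simp_all add: F_axis less_2_cases_iff)
  have P3: "P ?e3 = ((l2 - \<tau>) / 2) *\<^sub>R ?e3"
    using jb[OF J(3), of "\<lambda>j. if j = 0 then ?e3 else ?e4" 0] v by simp
  have P4: "P ?e4 = ((l2 - \<tau>) / 2) *\<^sub>R ?e4 + (1/2) *\<^sub>R ?e3"
    using jb[OF J(3), of "\<lambda>j. if j = 0 then ?e3 else ?e4" 1] v by simp
  interpret cf: conformally_flat_algebra4 B N P by (rule sch(1))
  interpret jordan_1_12 B N P ?e1 ?e2 "(1/2) *\<^sub>R ?e3" ?e4 "(l1 - \<tau>) / 2" "(l2 - \<tau>) / 2"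
  proof
    fix x :: "real ^ 4"
    show "\<exists>c0 c1 c2 c3. x = c0 *\<^sub>R ?e1 + c1 *\<^sub>R ?e2 + c2 *\<^sub>R ((1/2) *\<^sub>R ?e3) + c3 *\<^sub>R ?e4"
      by (rule exI[of _ "x $ 1"], rule exI[of _ "x $ 2"], rule exI[of _ "2 * x $ 3"], rule exI[of _ "x $ 4"])
        (simp add: axis_expand[of x, symmetric])
  next
    show "B ?e1 ?e1 > 0" using pos by (simp add: B_def F_axis)
  next
    show "(l1 - \<tau>) / 2 \<noteq> (l2 - \<tau>) / 2" using l by simp
  next
    fix a b assume "a *\<^sub>R ?e2 + b *\<^sub>R ((1/2) *\<^sub>R ?e3) = 0"
    then have "(a *\<^sub>R ?e2 + b *\<^sub>R ((1/2) *\<^sub>R ?e3)) $ 2 = 0" "(a *\<^sub>R ?e2 + b *\<^sub>R ((1/2) *\<^sub>R ?e3)) $ 3 = 0"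
      by simp_all
    then show "a = 0 \<and> b = 0" by (simp add: axis_def)
  qed (use P1 P2 P3 P4 cf.P_lin in \<open>simp_all add: algebra_simps\<close>)
  show False using no_walker walker_structure_algebra[OF sch(1) D] by blast
qed

lemma no_walker_13:
  assumes cf: "conformally_flat A g" and Q: "ricci_operator A g nab Q"
    and J: "jordan_block Q l 1 V" "jordan_block Q l 3 (\<lambda>j. V (1 + j))"
    and pos: "g 0 (V 0 0) (V 0 0) > 0" and orth: "\<forall>j\<in>{1..3}. g 0 (V 0 0) (V j 0) = 0"
  shows "\<not> walker_structure A g nab D"
proof
  assume D: "walker_structure A g nab D"
  obtain P \<tau> where sch: "conformally_flat_algebra4 B N P" "\<forall>a. Q (F a) = F (\<tau> *\<^sub>R a + 2 *\<^sub>R P a)"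
    using schouten_operator[OF cf Q] by blast
  note jb = jordan_block_schouten[where P = P and \<tau> = \<tau>, OF sch(2)[rule_format]]
  let ?e1 = "axis 1 1 :: real ^ 4" and ?e2 = "axis 2 1 :: real ^ 4"
    and ?e3 = "axis 3 1 :: real ^ 4" and ?e4 = "axis 4 1 :: real ^ 4"
  have P1: "P ?e1 = ((l - \<tau>) / 2) *\<^sub>R ?e1"
    using jb[OF J(1), of "\<lambda>j. ?e1" 0] by (simp add: F_axis)
  define v where "v j = (if j = 0 then ?e2 else if j = 1 then ?e3 else ?e4)" for j :: nat
  have v: "V (1 + j) = F (v j)" if j: "j < 3" for j
  proof -
    consider "j = 0" | "j = 1" | "j = 2" using j by linarith
    then show ?thesis by cases (simp_all add: v_def F_axis numeral_2_eq_2 numeral_3_eq_3)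
  qed
  have P2: "P ?e2 = ((l - \<tau>) / 2) *\<^sub>R ?e2"
    using jb[OF J(2) v, of 0] by (simp add: v_def)
  have P3: "P ?e3 = ((l - \<tau>) / 2) *\<^sub>R ?e3 + (1/2) *\<^sub>R ?e2"
    using jb[OF J(2) v, of 1] by (simp add: v_def)
  have P4: "P ?e4 = ((l - \<tau>) / 2) *\<^sub>R ?e4 + (1/2) *\<^sub>R ?e3"
    using jb[OF J(2) v, of 2] by (simp add: v_def)
  interpret cf: conformally_flat_algebra4 B N P by (rule sch(1))
  have orth': "B ?e1 ?e2 = 0" "B ?e1 ?e3 = 0" "B ?e1 ?e4 = 0"
    using orth by (simp_all add: B_def F_axis)
  interpret jordan_13 B N P ?e1 "(1/4) *\<^sub>R ?e2" "(1/2) *\<^sub>R ?e3" ?e4 "(l - \<tau>) / 2"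
  proof
    fix x :: "real ^ 4"
    show "\<exists>c0 c1 c2 c3. x = c0 *\<^sub>R ?e1 + c1 *\<^sub>R ((1/4) *\<^sub>R ?e2) + c2 *\<^sub>R ((1/2) *\<^sub>R ?e3) + c3 *\<^sub>R ?e4"
      by (rule exI[of _ "x $ 1"], rule exI[of _ "4 * x $ 2"], rule exI[of _ "2 * x $ 3"], rule exI[of _ "x $ 4"])
        (simp add: axis_expand[of x, symmetric])
  next
    show "B ?e1 ?e1 > 0" using pos by (simp add: B_def F_axis)
  qed (use P1 P2 P3 P4 cf.P_lin orth' in \<open>simp_all add: algebra_simps B_lin\<close>)
  show False using no_walker walker_structure_algebra[OF sch(1) D] by blast
qed

end

theorem theorem4p1:
  fixes A :: "'g::{topological_group_add, t2_space, second_countable_topology} chart set"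
    and g :: "'g metric"
    and nab :: "'g connection"
    and Q :: "'g vfield \<Rightarrow> 'g vfield"
  assumes "lie_group A"
    and "left_invariant_metric A g"
    and "lorentzian A g \<or> neutral A g"
    and "levi_civita A g nab"
    and "ricci_operator A g nab Q"
    and "conformally_flat A g"
    and "\<not> ricci_parallel A g nab"
    and "segre_1_c_12 A g Q \<or> segre_13 A g Q"
  shows "\<not> (\<exists>D. walker_structure A g nab D)"
proof -
  have loc: "metric_lie_group A g nab V" if "left_invariant_frame A 4 V" for V
  proof
    show "smooth_atlas A" using assms(1) by (simp add: lie_group_def)
    show "\<exists>e. pseudo_orthonormal_basis A g p e" for p
      using assms(3) unfolding has_signature_def by blast
  qed (fact assms that)+
  from assms(8) show ?thesis
  proof
    assume "segre_1_c_12 A g Q"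
    then obtain l1 l2 V where "l1 \<noteq> l2" and fr: "left_invariant_frame A 4 V" and "jordan_block Q l1 1 V"
      "jordan_block Q l2 1 (\<lambda>j. V (1 + j))" "jordan_block Q l2 2 (\<lambda>j. V (2 + j))"
      "\<forall>p. g p (V 0 p) (V 0 p) > 0"
      unfolding segre_1_c_12_def by (elim exE conjE)
    then show ?thesis
      using metric_lie_group.no_walker_1_12[OF loc[OF fr] assms(6,5)] by blast
  next
    assume "segre_13 A g Q"
    then obtain l V where fr: "left_invariant_frame A 4 V" and "jordan_block Q l 1 V"
      "jordan_block Q l 3 (\<lambda>j. V (1 + j))"
      "\<forall>p. g p (V 0 p) (V 0 p) > 0 \<and> (\<forall>j\<in>{1..3}. g p (V 0 p) (V j p) = 0)"
      unfolding segre_13_def by (elim exE conjE)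
    then show ?thesis
      using metric_lie_group.no_walker_13[OF loc[OF fr] assms(6,5)] by blast
  qed
qed

end
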